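(* Let $f:\mathbb{E}\to\mathbb{R}$ be twice differentiable, $\mu$-strongly convex, with $L$-Lipschitz gradient and $L_2$-Lipschitz Hessian (see context), with minimizer $x_*$ and $f_*=f(x_* )$. Let $H:=\sqrt2\,L_2/\mu^{3/2}$. Let $\eta_1\in(0,\tfrac12)$ and let $(x_k)_{k\ge0}$ be generated by the BFGS method (see context) from $x_0\in\mathbb{E}$ and a positive definite $H_0$, with step sizes $h_k=2^{-i_k}$, where $i_k$ is the smallest integer $i\ge0$ such that $f(x_k)-f(x_k-2^{-i}d_k)\ge\eta_12^{-i}\langle\nabla f(x_k),d_k\rangle$. Put $\sigma_k:=\sqrt{f(x_k)-f_*}$, $r_k:=\langle\nabla^2f(x_* )(x_k-x_* ),x_k-x_*\rangle^{1/2}$. Let $S$ be a real number such that $H\sum_{i=0}^{k-1}\sigma_i\le S$ for all $k\ge1$, and let $\Omega:=\psi(\nabla^2f(x_* ),H_0^{-1})+2S$. Let $K_0^L\ge0$ be an integer such that $$H\sigma_{K_0^L}\le0.06\,(1-2\eta_1).$$ Then, for all $k\ge1$, $$r_{K_0^L+k}\le\Bigl[2.02\,\omega^{-1}\Bigl(\frac{\Omega}{k}\Bigr)+\frac1k(\Upsilon\Omega+S)\Bigr]^kr_{K_0^L}\le\Bigl[2.02\sqrt{\frac{2\Omega}{k}}+\frac1k\bigl((\Upsilon+2.02)\Omega+S\bigr)\Bigr]^kr_{K_0^L},$$ where $\Upsilon:=[\omega_*(\bar t)]^{-1}$ with $\bar t:=0.9\,\dfrac{1-2\eta_1}{2(1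-\eta_1)}$.
   Context: $\mathbb{E}$ is a real vector space of finite dimension $n\ge1$, $\mathbb{E}^*$ its dual, $\langle s,x\rangle$ the value of $s\in\mathbb{E}^*$ at $x\in\mathbb{E}$. $B:\mathbb{E}\to\mathbb{E}^*$ is a fixed self-adjoint positive definite operator; $\|u\|=\langle Bu,u\rangle^{1/2}$, $\|s\|_*=\langle s,B^{-1}s\rangle^{1/2}$; operators $\mathbb{E}\to\mathbb{E}^*$ carry the induced operator norm. With $\mu,L>0$, $L_2\ge0$, the assumptions on $f$ are, for all $x,y$: $\langle\nabla f(x)-\nabla f(y),x-y\rangle\ge\mu\|x-y\|^2$, $\|\nabla f(x)-\nabla f(y)\|_*\le L\|x-y\|$, $\|\nabla^2f(x)-\nabla^2f(y)\|\le L_2\|x-y\|$. For self-adjoint positive definite $X,Y:\mathbb{E}\to\mathbb{E}^*$, $\psi(X,Y):=\operatorname{Tr}(X^{-1}(Y-X))-\ln\det(X^{-1}Y)\ (\ge0)$. $\omega(t)=t-\ln(1+t)$; $\omega^{-1}:[0,\infty)\to[0,\infty)$ is the inverse of $\omega$ restricted to $[0,\infty)$; $\omega_*(\tau)=-\tau-\ln(1-\tau)$ for $\tau\in[0,1)$. BFGS method: given $x_0$ and self-adjoint positive definite $H_0:\mathbb{E}^*\to\mathbb{E}$, for $k\ge0$: $d_k=H_k\nabla f(x_k)$; choose a step size $h_k>0$; $x_{k+1}=x_k-h_kd_k$; $\delta_k=x_{k+1}-x_k$, $\gamma_k=\nabla f(x_{k+1})-\nabla f(x_k)$; $$H_{k+1}=H_k-\frac{H_k\gamma_k\delta_k^*+\delta_k\gamma_k^*H_k}{\langle\gamma_k,\delta_k\rangle}+\Bigl(\frac{\langle\gamma_k,H_k\gamma_k\rangle}{\langle\gamma_k,\delta_k\rangle}+1\Bigr)\frac{\delta_k\delta_k^*}{\langle\gamma_k,\delta_k\rangle},$$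 where, e.g., $(\delta\delta^* )s=\langle s,\delta\rangle\delta$ and $(H\gamma\delta^* )s=\langle s,\delta\rangle H\gamma$. Equivalently, $G_k:=H_k^{-1}$ satisfies $G_{k+1}=G_k-\frac{G_k\delta_k\delta_k^*G_k}{\langle G_k\delta_k,\delta_k\rangle}+\frac{\gamma_k\gamma_k^*}{\langle\gamma_k,\delta_k\rangle}$. Standing assumption: $\langle\gamma_k,\delta_k\rangle>0$ for all $k\ge0$ (otherwise the method has already found the minimizer). All $H_k$ are then positive definite. (The scalar constant $H$ is unrelated to the operators $H_k$.) *)

theory Defs
  imports "HOL-Analysis.Analysis"
begin

text \<open>
  The space is an arbitrary Euclidean space \<open>'a\<close>, used only as a nontrivial finite-dimensional real
  vector space with its topology. Its dual is \<open>'a \<Rightarrow>\<^sub>L real\<close>, and no identification of the two is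
  made; all norms below come from the operator \<open>B\<close>, not from the type classes.
  Operators are plain functions whose linearity is a separate hypothesis.
\<close>

abbreviation pairing :: "('a::real_normed_vector \<Rightarrow>\<^sub>L real) \<Rightarrow> 'a \<Rightarrow> real"
    ("\<langle>_, _\<rangle>")
  where "\<langle>s, x\<rangle> \<equiv> blinfun_apply s x"

definition spd_op :: "('a::real_normed_vector \<Rightarrow> ('a \<Rightarrow>\<^sub>L real)) \<Rightarrow> bool" where
  "spd_op A \<longleftrightarrow> linear A \<and> (\<forall>u v. \<langle>A u, v\<rangle> = \<langle>A v, u\<rangle>) \<and> (\<forall>u. u \<noteq> 0 \<longrightarrow> 0 < \<langle>A u, u\<rangle>)"

definition spd_dual_op :: "(('a::real_normed_vector \<Rightarrow>\<^sub>L real) \<Rightarrow> 'a) \<Rightarrow> bool" where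
  "spd_dual_op H \<longleftrightarrow> linear H \<and> (\<forall>s t. \<langle>s, H t\<rangle> = \<langle>t, H s\<rangle>) \<and> (\<forall>s. s \<noteq> 0 \<longrightarrow> 0 < \<langle>s, H s\<rangle>)"

definition primal_norm :: "('a::real_normed_vector \<Rightarrow> ('a \<Rightarrow>\<^sub>L real)) \<Rightarrow> 'a \<Rightarrow> real" where
  "primal_norm B u = sqrt \<langle>B u, u\<rangle>"

definition dual_norm ::
    "('a::real_normed_vector \<Rightarrow> ('a \<Rightarrow>\<^sub>L real)) \<Rightarrow> ('a \<Rightarrow>\<^sub>L real) \<Rightarrow> real" where
  "dual_norm B s = sqrt \<langle>s, inv B s\<rangle>"

definition op_norm ::
    "('a::real_normed_vector \<Rightarrow> ('a \<Rightarrow>\<^sub>L real)) \<Rightarrow> ('a \<Rightarrow> ('a \<Rightarrow>\<^sub>L real)) \<Rightarrow> real" where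
  "op_norm B A = (SUP u\<in>{u. primal_norm B u \<le> 1}. dual_norm B (A u))"

text \<open>
  Trace and determinant of an endomorphism are those of its matrix in the orthonormal basis
  \<open>Basis\<close>; they do not depend on the basis. The index type has exactly one element per basis
  vector, so that the library's matrices can be used on an abstract Euclidean space.
\<close>

typedef (overloaded) 'a basis_index = "Basis :: 'a::euclidean_space set"
  morphisms basis_vec Basis_index
  using nonempty_Basis by blast

instance basis_index :: (euclidean_space) finite
proof
  have "range (basis_vec :: 'a basis_index \<Rightarrow> 'a) = Basis"
    using type_definition.Rep_range[OF type_definition_basis_index] .
  moreover have "inj (basis_vec :: 'a basis_index \<Rightarrow> 'a)"
    by (simp add: inj_def basis_vec_inject)
  ultimately show "finite (UNIV :: 'a basis_index set)"
    using finite_imageD finite_Basis by metis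
qed

definition endo_matrix ::
    "('a::euclidean_space \<Rightarrow> 'a) \<Rightarrow> real ^ 'a basis_index ^ 'a basis_index" where
  "endo_matrix T = (\<chi> i j. T (basis_vec j) \<bullet> basis_vec i)"

definition psi ::
    "('a::euclidean_space \<Rightarrow> ('a \<Rightarrow>\<^sub>L real)) \<Rightarrow> ('a \<Rightarrow> ('a \<Rightarrow>\<^sub>L real)) \<Rightarrow> real" where
  "psi X Y = trace (endo_matrix (\<lambda>u. inv X (Y u - X u))) - ln (det (endo_matrix (\<lambda>u. inv X (Y u))))"

definition omega :: "real \<Rightarrow> real" where
  "omega t = t - ln (1 + t)"

definition omega_inv :: "real \<Rightarrow> real" where
  "omega_inv = the_inv_into {0..} omega"

definition omega_star :: "real \<Rightarrow> real" where
  "omega_star \<tau> = - \<tau> - ln (1 - \<tau>)"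

definition bfgs_update ::
    "(('a::real_normed_vector \<Rightarrow>\<^sub>L real) \<Rightarrow> 'a) \<Rightarrow> 'a \<Rightarrow> ('a \<Rightarrow>\<^sub>L real) \<Rightarrow> (('a \<Rightarrow>\<^sub>L real) \<Rightarrow> 'a)" where
  "bfgs_update H \<delta> \<gamma> = (\<lambda>s. H s
     - (1 / \<langle>\<gamma>, \<delta>\<rangle>) *\<^sub>R (\<langle>s, \<delta>\<rangle> *\<^sub>R H \<gamma> + \<langle>\<gamma>, H s\<rangle> *\<^sub>R \<delta>)
     + ((\<langle>\<gamma>, H \<gamma>\<rangle> / \<langle>\<gamma>, \<delta>\<rangle> + 1) * (1 / \<langle>\<gamma>, \<delta>\<rangle>)) *\<^sub>R (\<langle>s, \<delta>\<rangle> *\<^sub>R \<delta>))"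

text \<open>
  The sequences \<open>x\<close>, \<open>H\<close> are generated by BFGS with step sizes \<open>h\<close> for the gradient map \<open>g\<close>.
  The last conjunct is the standing assumption of positive curvature along the steps.
\<close>

definition bfgs_method ::
    "('a::real_normed_vector \<Rightarrow> ('a \<Rightarrow>\<^sub>L real)) \<Rightarrow> (nat \<Rightarrow> 'a)
      \<Rightarrow> (nat \<Rightarrow> ('a \<Rightarrow>\<^sub>L real) \<Rightarrow> 'a) \<Rightarrow> (nat \<Rightarrow> real) \<Rightarrow> bool" where
  "bfgs_method g x H h \<longleftrightarrow>
     spd_dual_op (H 0) \<and>
     (\<forall>k. 0 < h k
        \<and> x (Suc k) = x k - h k *\<^sub>R H k (g (x k))
        \<and> H (Suc k) = bfgs_update (H k) (x (Suc k) - x k) (g (x (Suc k)) - g (x k))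
        \<and> 0 < \<langle>g (x (Suc k)) - g (x k), x (Suc k) - x k\<rangle>)"

definition armijo ::
    "('a::real_normed_vector \<Rightarrow> real) \<Rightarrow> ('a \<Rightarrow> ('a \<Rightarrow>\<^sub>L real)) \<Rightarrow> real \<Rightarrow> 'a \<Rightarrow> 'a \<Rightarrow> nat \<Rightarrow> bool" where
  "armijo f g \<eta> y d i \<longleftrightarrow> f y - f (y - (1 / 2 ^ i) *\<^sub>R d) \<ge> \<eta> * (1 / 2 ^ i) * \<langle>g y, d\<rangle>"

definition backtracking_step ::
    "('a::real_normed_vector \<Rightarrow> real) \<Rightarrow> ('a \<Rightarrow> ('a \<Rightarrow>\<^sub>L real)) \<Rightarrow> real \<Rightarrow> 'a \<Rightarrow> 'a \<Rightarrow> real \<Rightarrow> bool" where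
  "backtracking_step f g \<eta> y d t \<longleftrightarrow>
     (\<exists>i. t = 1 / 2 ^ i \<and> armijo f g \<eta> y d i \<and> (\<forall>j<i. \<not> armijo f g \<eta> y d j))"

end

theory Submission
  imports Defs
begin

text \<open>
  With \<open>A = \<nabla>\<^sup>2f(x\<^sub>*)\<close> and \<open>s\<^sub>k = H \<sigma>\<^sub>k\<close>, every Hessian on the sublevel set of \<open>x\<^sub>k\<close> agrees with \<open>A\<close> up to
  the factor \<open>1 + s\<^sub>k\<close>, so that one BFGS update changes \<open>\<psi>(A, G\<^sub>k)\<close> by at most \<open>2 s\<^sub>k - \<Delta>\<^sub>k\<close>, where
  \<open>\<Delta>\<^sub>k \<ge> 0\<close> measures how far \<open>G\<^sub>k d\<^sub>k\<close> is from \<open>A d\<^sub>k\<close>. As \<open>\<psi> \<ge> 0\<close>, the sum of all \<open>\<Delta>\<^sub>k\<close> is at most \<open>\<Omega>\<close>.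
  After \<open>K\<^sub>0\<close>, an iteration either has \<open>\<Delta>\<^sub>k \<ge> \<omega>\<^sub>*(t)\<close>, which happens at most \<open>\<Upsilon>\<Omega>\<close> times, or it takes the
  unit step and contracts \<open>r\<^sub>k\<close> by \<open>2.02 z\<^sub>k + s\<^sub>k\<close> with \<open>\<omega>(z\<^sub>k) \<le> \<Delta>\<^sub>k\<close>. Convexity of \<open>\<omega>\<close> and the inequality
  of arithmetic and geometric means turn these sums into the bound on the product of the factors.
\<close>

section \<open>Positive definite operators\<close>

text \<open>Measuring against the fixed operator \<open>A\<close> makes the potential telescope; the
  price is the error \<open>2 s\<close> per update, one \<open>s\<close> from the trace and one from
  the logarithm of the determinant. With \<open>b\<close> for the quotient of
  \<open>\<langle>G d, d\<rangle>\<close> by \<open>\<langle>A d, d\<rangle>\<close>, an iteration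
  is bad if \<open>b \<le> 1 - t\<close>: \<open>G\<close> underestimates the curvature along
  \<open>d\<close>, so \<open>d\<close> may be too long for the line search, but
  \<open>b - 1 - ln b\<close> is then at least \<open>omega_star t\<close>. Of a bad iteration only
  descent is known, and descent costs at most the factor \<open>1 + s\<close>. Hence all iterations
  share the shape \<open>2.02 z + \<beta> + s\<close>, with \<open>\<beta>\<close> marking the bad
  ones. The constants hang together: the \<open>0.9\<close> in \<open>t\<close> leaves room for
  \<open>s\<close> in the Armijo condition, \<open>t \<le> 0.45\<close> keeps \<open>b\<close> above
  \<open>0.55\<close> in good iterations, and on that range the potential controls the distance of
  \<open>d\<close> from the exact step for \<open>A\<close>, with a constant that fits
  \<open>1.06 / 2.02\<close>, where \<open>1.06\<close> bounds \<open>1 + s\<close>.\<close>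

lemma spd_opD:
  assumes "spd_op A"
  shows "linear A" "\<langle>A u, v\<rangle> = \<langle>A v, u\<rangle>" "u \<noteq> 0 \<Longrightarrow> 0 < \<langle>A u, u\<rangle>" "0 \<le> \<langle>A u, u\<rangle>"
proof -
  show l: "linear A" and "\<langle>A u, v\<rangle> = \<langle>A v, u\<rangle>" and p: "u \<noteq> 0 \<Longrightarrow> 0 < \<langle>A u, u\<rangle>"
    using assms unfolding spd_op_def by auto
  show "0 \<le> \<langle>A u, u\<rangle>" by (cases "u = 0") (use p in auto)
qed

lemma dual_representation:
  fixes s :: "'a::euclidean_space \<Rightarrow>\<^sub>L real"
  shows "(\<Sum>b\<in>Basis. \<langle>s, b\<rangle> *\<^sub>R b) \<bullet> v = \<langle>s, v\<rangle>"
proof -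
  have "\<langle>s, v\<rangle> = \<langle>s, (\<Sum>b\<in>Basis. (v \<bullet> b) *\<^sub>R b)\<rangle>" by (simp add: euclidean_representation)
  also have "\<dots> = (\<Sum>b\<in>Basis. \<langle>s, b\<rangle> * (b \<bullet> v))"
    by (simp add: blinfun.sum_right blinfun.scaleR_right inner_commute mult.commute del: euclidean_representation)
  finally show ?thesis by (simp add: inner_sum_left)
qed

text \<open>The Riesz representation in the inner product of the type class turns \<open>A\<close>
  into an endomorphism \<open>T\<close>, for which injectivity implies surjectivity in finite
  dimension.\<close>

lemma linear_inj_dual_bij:
  fixes A :: "'a::euclidean_space \<Rightarrow> ('a \<Rightarrow>\<^sub>L real)"
  assumes l: "linear A" and inj: "\<And>u. A u = 0 \<Longrightarrow> u = 0"
  shows "bij A"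
proof (rule bijI)
  show "inj A" using l inj linear_injective_0 by blast
  interpret linear A by fact
  define T where "T u = (\<Sum>b\<in>Basis. \<langle>A u, b\<rangle> *\<^sub>R b)" for u
  have Tin: "T u \<bullet> v = \<langle>A u, v\<rangle>" for u v
    by (simp add: T_def dual_representation)
  have "linear T"
    unfolding T_def by (rule linearI)
      (simp_all add: add scale blinfun.add_left blinfun.scaleR_left scaleR_add_left sum.distrib scaleR_sum_right)
  moreover have "inj T"
  proof -
    have "u = 0" if "T u = 0" for u
      using Tin[of u] that by (intro inj blinfun_eqI) simp
    then show ?thesis using \<open>linear T\<close> linear_injective_0 by blast
  qed
  ultimately have "surj T" by (rule linear_inj_imp_surj)
  show "surj A"
  proof (rule surjI)
    fix s :: "'a \<Rightarrow>\<^sub>L real"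
    let ?z = "\<Sum>b\<in>Basis. \<langle>s, b\<rangle> *\<^sub>R b"
    let ?u = "inv T ?z"
    have "T ?u = ?z" using \<open>surj T\<close> by (simp add: surj_f_inv_f)
    show "A ?u = s"
    proof (rule blinfun_eqI)
      show "\<langle>A ?u, v\<rangle> = \<langle>s, v\<rangle>" for v
        unfolding Tin[symmetric] \<open>T ?u = ?z\<close> by (rule dual_representation)
    qed
  qed
qed

lemma spd_op_bij:
  fixes A :: "'a::euclidean_space \<Rightarrow> ('a \<Rightarrow>\<^sub>L real)"
  assumes "spd_op A"
  shows "bij A"
proof (rule linear_inj_dual_bij[OF spd_opD(1)[OF assms]])
  show "u = 0" if "A u = 0" for u using spd_opD(3)[OF assms, of u] that by auto
qed

lemma spd_op_inv [simp]:
  fixes A :: "'a::euclidean_space \<Rightarrow> ('a \<Rightarrow>\<^sub>L real)"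
  assumes "spd_op A"
  shows "A (inv A s) = s" "inv A (A u) = u"
  using spd_op_bij[OF assms] by (simp_all add: bij_is_surj bij_is_inj surj_f_inv_f)

lemma spd_op_linear_inv:
  fixes A :: "'a::euclidean_space \<Rightarrow> ('a \<Rightarrow>\<^sub>L real)"
  assumes "spd_op A"
  shows "linear (inv A)"
proof (rule linearI)
  have "inj A" using spd_op_bij[OF assms] by (rule bij_is_inj)
  note * = injD[OF this] linear_add[OF spd_opD(1)[OF assms]] linear_scale[OF spd_opD(1)[OF assms]]
  show "inv A (s + t) = inv A s + inv A t" for s t by (rule *(1)) (simp add: * assms)
  show "inv A (a *\<^sub>R s) = a *\<^sub>R inv A s" for a s by (rule *(1)) (simp add: * assms)
qed

lemma spd_op_cauchy:
  assumes A: "spd_op A"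
  shows "\<langle>A u, v\<rangle>\<^sup>2 \<le> \<langle>A u, u\<rangle> * \<langle>A v, v\<rangle>"
proof (cases "v = 0")
  case False
  interpret linear A by (rule spd_opD(1)[OF A])
  have p: "0 < \<langle>A v, v\<rangle>" by (rule spd_opD(3)[OF A False])
  define t where "t = \<langle>A u, v\<rangle> / \<langle>A v, v\<rangle>"
  have "0 \<le> \<langle>A (u - t *\<^sub>R v), u - t *\<^sub>R v\<rangle>" by (rule spd_opD(4)[OF A])
  also have "\<dots> = \<langle>A u, u\<rangle> - 2 * t * \<langle>A u, v\<rangle> + t\<^sup>2 * \<langle>A v, v\<rangle>"
    using spd_opD(2)[OF A, of v u]
    by (simp add: diff scale blinfun.diff_left blinfun.diff_right blinfun.scaleR_left blinfun.scaleR_right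
        power2_eq_square algebra_simps)
  also have "\<dots> = \<langle>A u, u\<rangle> - \<langle>A u, v\<rangle>\<^sup>2 / \<langle>A v, v\<rangle>"
    using p by (simp add: t_def field_simps power2_eq_square)
  finally show ?thesis using p by (simp add: field_simps)
qed simp

lemma primal_norm_nonneg [simp]: "spd_op A \<Longrightarrow> 0 \<le> primal_norm A u"
  by (simp add: primal_norm_def spd_opD)

lemma primal_norm_power2 [simp]: "spd_op A \<Longrightarrow> (primal_norm A u)\<^sup>2 = \<langle>A u, u\<rangle>"
  by (simp add: primal_norm_def spd_opD)

lemma primal_norm_scaleR: "spd_op A \<Longrightarrow> primal_norm A (a *\<^sub>R u) = \<bar>a\<bar> * primal_norm A u"
  using spd_opD(1)[of A]
  by (simp add: primal_norm_def linear_cmul blinfun.scaleR_left blinfun.scaleR_right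
      real_sqrt_mult flip: mult.assoc)

lemma primal_norm_minus: "spd_op A \<Longrightarrow> primal_norm A (- u) = primal_norm A u"
  using primal_norm_scaleR[of A "-1" u] by simp

lemma primal_norm_cauchy:
  assumes A: "spd_op A"
  shows "\<bar>\<langle>A u, v\<rangle>\<bar> \<le> primal_norm A u * primal_norm A v"
  using real_sqrt_le_mono[OF spd_op_cauchy[OF A, of u v]]
  by (simp add: primal_norm_def real_sqrt_mult)

lemma primal_norm_triangle:
  assumes A: "spd_op A"
  shows "primal_norm A (u + v) \<le> primal_norm A u + primal_norm A v"
proof (rule power2_le_imp_le)
  have "(primal_norm A (u + v))\<^sup>2 = \<langle>A u, u\<rangle> + 2 * \<langle>A u, v\<rangle> + \<langle>A v, v\<rangle>"
    using A spd_opD(2)[OF A, of v u] linear_add[OF spd_opD(1)[OF A]]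
    by (simp add: blinfun.add_left blinfun.add_right)
  also have "\<dots> \<le> (primal_norm A u + primal_norm A v)\<^sup>2"
    using A primal_norm_cauchy[OF A, of u v] by (simp add: power2_sum)
  finally show "(primal_norm A (u + v))\<^sup>2 \<le> (primal_norm A u + primal_norm A v)\<^sup>2" .
qed (use A in simp)

section \<open>Dual norms and the operator norm\<close>

lemma dual_norm_eq:
  fixes A :: "'a::euclidean_space \<Rightarrow> ('a \<Rightarrow>\<^sub>L real)"
  shows "spd_op A \<Longrightarrow> dual_norm A s = primal_norm A (inv A s)"
  by (simp add: dual_norm_def primal_norm_def)

lemma dual_norm_nonneg [simp]:
  fixes A :: "'a::euclidean_space \<Rightarrow> ('a \<Rightarrow>\<^sub>L real)"
  shows "spd_op A \<Longrightarrow> 0 \<le> dual_norm A s"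
  by (simp add: dual_norm_eq)

lemma dual_norm_cauchy:
  fixes A :: "'a::euclidean_space \<Rightarrow> ('a \<Rightarrow>\<^sub>L real)"
  assumes A: "spd_op A"
  shows "\<bar>\<langle>s, v\<rangle>\<bar> \<le> dual_norm A s * primal_norm A v"
  using primal_norm_cauchy[OF A, of "inv A s" v] A by (simp add: dual_norm_eq)

text \<open>The extremal vector is \<open>v = inv A s\<close>; there the assumed bound reads
  \<open>n * n \<le> C * n\<close>, with \<open>n\<close> the dual norm of \<open>s\<close>.\<close>

lemma dual_norm_le:
  fixes A :: "'a::euclidean_space \<Rightarrow> ('a \<Rightarrow>\<^sub>L real)"
  assumes A: "spd_op A" and "0 \<le> C" and le: "\<And>v. \<langle>s, v\<rangle> \<le> C * primal_norm A v"
  shows "dual_norm A s \<le> C"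
proof -
  let ?n = "dual_norm A s"
  have "?n * ?n = \<langle>s, inv A s\<rangle>"
    using A primal_norm_power2[OF A, of "inv A s"] by (simp add: dual_norm_eq power2_eq_square)
  also have "\<dots> \<le> C * ?n" using le[of "inv A s"] A by (simp add: dual_norm_eq)
  finally show ?thesis using dual_norm_nonneg[OF A, of s] \<open>0 \<le> C\<close>
    by (cases "?n = 0") (auto simp: mult_le_cancel_right)
qed

text \<open>Links the norm of \<open>A\<close> to that of the type class, so that the supremum in
  \<open>op_norm\<close> can be shown finite. The square of \<open>norm u\<close> is the value at
  \<open>u\<close> of the inner product functional of \<open>u\<close>, whose dual norm is at most
  \<open>sqrt K * norm u\<close> because \<open>inv A\<close> is bounded.\<close>

lemma norm_le_primal_norm:
  fixes A :: "'a::euclidean_space \<Rightarrow> ('a \<Rightarrow>\<^sub>L real)"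
  assumes A: "spd_op A"
  obtains C where "0 \<le> C" "\<And>u. norm u \<le> C * primal_norm A u"
proof -
  interpret i: linear "inv A" by (rule spd_op_linear_inv[OF A])
  interpret l: bounded_linear "blinfun_inner_right :: 'a \<Rightarrow> _" by (rule bounded_linear_blinfun_inner_right)
  have "linear (\<lambda>u. inv A (blinfun_inner_right u))"
    by (rule linearI) (simp_all add: l.add l.scaleR i.add i.scale)
  then have bl: "bounded_linear (\<lambda>u. inv A (blinfun_inner_right u))"
    by (rule linear_conv_bounded_linear[THEN iffD1])
  then obtain K where K: "0 < K" "\<And>u. norm (inv A (blinfun_inner_right u)) \<le> norm u * K"
    using bounded_linear.pos_bounded by blast
  have "norm u \<le> sqrt K * primal_norm A u" for u
  proof (cases "u = 0")
    case False
    let ?s = "blinfun_inner_right u"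
    have d: "(dual_norm A ?s)\<^sup>2 \<le> K * (norm u)\<^sup>2"
    proof -
      have "(dual_norm A ?s)\<^sup>2 = u \<bullet> inv A ?s" 
        using A primal_norm_power2[OF A, of "inv A ?s"] by (simp add: dual_norm_eq)
      also have "\<dots> \<le> norm u * norm (inv A ?s)" by (rule norm_cauchy_schwarz)
      also have "\<dots> \<le> norm u * (norm u * K)" by (intro mult_left_mono K) simp
      finally show ?thesis by (simp add: power2_eq_square mult_ac)
    qed
    then have d': "dual_norm A ?s \<le> sqrt K * norm u"
      using real_sqrt_le_mono[OF d] A by (simp add: real_sqrt_mult)
    have "norm u * norm u = \<langle>?s, u\<rangle>" by (simp add: dot_square_norm power2_eq_square)
    also have "\<dots> \<le> dual_norm A ?s * primal_norm A u" using dual_norm_cauchy[OF A, of ?s u] by simp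
    also have "\<dots> \<le> (sqrt K * norm u) * primal_norm A u" by (intro mult_right_mono d') (use A in simp)
    finally have "norm u * norm u \<le> norm u * (sqrt K * primal_norm A u)" by (simp add: mult_ac)
    then show ?thesis using False by simp
  qed (use A in \<open>simp add: primal_norm_def\<close>)
  then show thesis using that[of "sqrt K"] K by simp
qed

text \<open>A real supremum bounds its members only if they are bounded above; this is settled
  through the norms of the type class, and then \<open>u\<close> is scaled to norm one.\<close>

lemma op_norm_bound:
  fixes B E :: "'a::euclidean_space \<Rightarrow> ('a \<Rightarrow>\<^sub>L real)"
  assumes B: "spd_op B" and E: "linear E"
  shows "\<bar>\<langle>E u, v\<rangle>\<bar> \<le> op_norm B E * primal_norm B u * primal_norm B v"
proof -
  interpret linear E by fact
  obtain C where C: "0 \<le> C" "\<And>u. norm u \<le> C * primal_norm B u" using norm_le_primal_norm[OF B] by blast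
  obtain K where K: "0 < K" "\<And>u. norm (E u) \<le> norm u * K"
    using E linear_conv_bounded_linear bounded_linear.pos_bounded by blast
  have "dual_norm B (E u) \<le> C * C * K" if "primal_norm B u \<le> 1" for u
  proof (rule dual_norm_le[OF B])
    fix v
    have "\<langle>E u, v\<rangle> \<le> norm (E u) * norm v" using norm_blinfun[of "E u" v] by simp
    also have "\<dots> \<le> (C * K) * (C * primal_norm B v)"
    proof (intro mult_mono C)
      have "norm (E u) \<le> norm u * K" by (rule K)
      also have "\<dots> \<le> (C * primal_norm B u) * K" using K C by (intro mult_right_mono) auto
      also have "\<dots> \<le> (C * 1) * K" using that C K by (intro mult_right_mono mult_left_mono) auto
      finally show "norm (E u) \<le> C * K" by simp
    qed (use C K in auto)
    finally show "\<langle>E u, v\<rangle> \<le> C * C * K * primal_norm B v" by (simp add: mult_ac)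
  qed (use C K in auto)
  then have bdd: "bdd_above ((\<lambda>u. dual_norm B (E u)) ` {u. primal_norm B u \<le> 1})"
    by (intro bdd_aboveI2) auto
  show ?thesis
  proof (cases "u = 0")
    case False
    define a where "a = primal_norm B u"
    have a: "0 < a" using spd_opD(3)[OF B False] by (simp add: a_def primal_norm_def)
    have "primal_norm B ((1/a) *\<^sub>R u) \<le> 1" using a B by (simp add: primal_norm_scaleR flip: a_def)
    then have "dual_norm B (E ((1/a) *\<^sub>R u)) \<le> op_norm B E"
      unfolding op_norm_def using cSUP_upper[OF _ bdd] by simp
    then have "dual_norm B (E ((1/a) *\<^sub>R u)) * primal_norm B v \<le> op_norm B E * primal_norm B v"
      using B by (simp add: mult_right_mono)
    then have "\<bar>\<langle>E ((1/a) *\<^sub>R u), v\<rangle>\<bar> \<le> op_norm B E * primal_norm B v"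
      by (rule order.trans[OF dual_norm_cauchy[OF B]])
    then show ?thesis using a 
      by (simp add: scale blinfun.scaleR_left abs_mult field_simps flip: a_def)
  qed (simp add: primal_norm_def)
qed

section \<open>The potential function and the BFGS update\<close>

lemma sum_basis_vec: "(\<Sum>k\<in>UNIV. g (basis_vec k)) = (\<Sum>b\<in>(Basis :: 'a::euclidean_space set). g b)"
proof -
  have "bij_betw (basis_vec :: 'a basis_index \<Rightarrow> 'a) UNIV Basis"
    unfolding bij_betw_def using type_definition.Rep_range[OF type_definition_basis_index]
    by (auto simp: inj_def basis_vec_inject)
  then show ?thesis by (rule sum.reindex_bij_betw)
qed

lemma endo_matrix_comp:
  fixes S T :: "'a::euclidean_space \<Rightarrow> 'a"
  assumes "linear S"
  shows "endo_matrix (\<lambda>u. S (T u)) = endo_matrix S ** endo_matrix T"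
proof -
  interpret linear S by fact
  have "S v \<bullet> a = (\<Sum>k\<in>UNIV. (S (basis_vec k) \<bullet> a) * (v \<bullet> basis_vec k))" for v a
  proof -
    have "S v = S (\<Sum>b\<in>Basis. (v \<bullet> b) *\<^sub>R b)" by (simp add: euclidean_representation)
    also have "\<dots> = (\<Sum>b\<in>Basis. (v \<bullet> b) *\<^sub>R S b)" by (simp add: sum scale del: euclidean_representation)
    finally show ?thesis
      by (simp add: inner_sum_left mult.commute sum_basis_vec[of "\<lambda>b. (v \<bullet> b) * (S b \<bullet> a)"])
  qed
  from this[of "T _" "basis_vec _"] show ?thesis
    unfolding vec_eq_iff endo_matrix_def matrix_matrix_mult_def vec_lambda_beta by blast
qed

lemma endo_matrix_id: "endo_matrix (\<lambda>u. u) = mat 1"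
proof -
  have "basis_vec j \<bullet> basis_vec i = (if i = j then 1 else 0 :: real)" for i j :: "'a basis_index"
    using inner_Basis[OF basis_vec[of j] basis_vec[of i]] by (auto simp: basis_vec_inject)
  then show ?thesis by (simp add: endo_matrix_def mat_def vec_eq_iff)
qed

lemma endo_matrix_add: "endo_matrix (\<lambda>u. S u + T u) = endo_matrix S + endo_matrix T"
  by (simp add: endo_matrix_def vec_eq_iff inner_add_left)

lemma trace_endo_matrix_rank_one:
  fixes s :: "'a::euclidean_space \<Rightarrow>\<^sub>L real"
  shows "trace (endo_matrix (\<lambda>u. \<langle>s, u\<rangle> *\<^sub>R a)) = \<langle>s, a\<rangle>"
proof -
  have "trace (endo_matrix (\<lambda>u. \<langle>s, u\<rangle> *\<^sub>R a)) = (\<Sum>b\<in>Basis. \<langle>s, b\<rangle> * (a \<bullet> b))"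
    by (simp add: trace_def endo_matrix_def sum_basis_vec[of "\<lambda>b. \<langle>s, b\<rangle> * (a \<bullet> b)"])
  also have "\<dots> = \<langle>s, a\<rangle>"
    using dual_representation[of s a] unfolding inner_sum_left inner_scaleR_left inner_commute[of a] .
  finally show ?thesis .
qed

text \<open>
  Conjugating by an invertible matrix whose row \<open>k\<close> is \<open>v\<close> reduces to a matrix that differs from
  the identity in column \<open>k\<close> only, for which Cramer's rule gives the determinant.
\<close>

lemma det_identity_plus_rank_one:
  fixes a v :: "real ^ 'n"
  shows "det (mat 1 + (\<chi> i j. a $ i * v $ j)) = 1 + (\<Sum>i\<in>UNIV. v $ i * a $ i)"
proof (cases "v = 0")
  case False
  then obtain k where k: "v $ k \<noteq> 0" by (auto simp: vec_eq_iff)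
  define R :: "real ^ 'n ^ 'n" where "R = (\<chi> i. if i = k then v else row i (mat 1))"
  have rep: "(\<Sum>i\<in>UNIV. v $ i *s row i (mat 1 :: real ^ 'n ^ 'n)) = v"
    by (simp add: vec_eq_iff row_def mat_def if_distrib cong: if_cong)
  have "det R = v $ k"
    using cramer_lemma_transpose[of k v "mat 1 :: real ^ 'n ^ 'n"] unfolding rep R_def[symmetric] by simp
  define y where "y = R *v a"
  define C :: "real ^ 'n ^ 'n" where "C = (\<chi> i j. if j = k then (mat 1 *v (axis k 1 + y)) $ i else mat 1 $ i $ j)"
  have "R ** (mat 1 + (\<chi> i j. a $ i * v $ j)) = C ** R"
  proof -
    have 1: "(R ** (\<chi> i j. a $ i * v $ j)) $ i $ j = y $ i * v $ j" for i j
      by (simp add: y_def matrix_matrix_mult_def matrix_vector_mult_def sum_distrib_left mult_ac)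
    have 2: "C $ i $ l = mat 1 $ i $ l + (if l = k then y $ i else 0)" for i l
      unfolding C_def matrix_vector_mul_lid by (simp add: axis_def mat_def)
    have 3: "(C ** R) $ i $ j = (mat 1 ** R) $ i $ j + y $ i * R $ k $ j" for i j
      by (simp add: matrix_matrix_mult_def 2 distrib_right sum.distrib if_distrib[of "\<lambda>x. x * _"] cong: if_cong)
    show ?thesis
      by (simp add: vec_eq_iff matrix_add_ldistrib 1 3) (simp add: R_def)
  qed
  then have "det R * det (mat 1 + (\<chi> i j. a $ i * v $ j)) = det C * det R"
    by (metis det_mul)
  then have "det (mat 1 + (\<chi> i j. a $ i * v $ j)) = det C" using k \<open>det R = v $ k\<close> by simp
  also have "\<dots> = 1 + y $ k" unfolding C_def by (subst cramer_lemma) (simp add: axis_def)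
  also have "y $ k = (\<Sum>i\<in>UNIV. v $ i * a $ i)"
    by (simp add: y_def R_def matrix_vector_mult_def)
  finally show ?thesis .
qed (simp add: zero_vec_def[symmetric])

lemma det_endo_matrix_rank_one:
  fixes s :: "'a::euclidean_space \<Rightarrow>\<^sub>L real"
  shows "det (endo_matrix (\<lambda>u. u + \<langle>s, u\<rangle> *\<^sub>R a)) = 1 + \<langle>s, a\<rangle>"
proof -
  let ?v = "\<chi> j. \<langle>s, basis_vec j\<rangle>" and ?a = "\<chi> i. a \<bullet> basis_vec i"
  have *: "endo_matrix (\<lambda>u. \<langle>s, u\<rangle> *\<^sub>R a) = (\<chi> i j. ?a $ i * ?v $ j)"
    by (simp add: endo_matrix_def vec_eq_iff)
  have "det (endo_matrix (\<lambda>u. u + \<langle>s, u\<rangle> *\<^sub>R a)) = 1 + (\<Sum>i\<in>UNIV. ?v $ i * ?a $ i)"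
    unfolding endo_matrix_add endo_matrix_id * by (rule det_identity_plus_rank_one)
  also have "(\<Sum>i\<in>UNIV. ?v $ i * ?a $ i) = trace (endo_matrix (\<lambda>u. \<langle>s, u\<rangle> *\<^sub>R a))"
    by (simp add: trace_def endo_matrix_def)
  finally show ?thesis by (simp add: trace_endo_matrix_rank_one)
qed

section \<open>The update of the inverse operator\<close>

definition bfgs_direct ::
    "('a::real_normed_vector \<Rightarrow> ('a \<Rightarrow>\<^sub>L real)) \<Rightarrow> 'a \<Rightarrow> ('a \<Rightarrow>\<^sub>L real) \<Rightarrow> ('a \<Rightarrow> ('a \<Rightarrow>\<^sub>L real))" where
  "bfgs_direct G \<delta> \<gamma> u =
     G u - (\<langle>G \<delta>, u\<rangle> / \<langle>G \<delta>, \<delta>\<rangle>) *\<^sub>R G \<delta> + (\<langle>\<gamma>, u\<rangle> / \<langle>\<gamma>, \<delta>\<rangle>) *\<^sub>R \<gamma>"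

text \<open>The functional \<open>w\<close> of the factor \<open>I + \<delta> w\<^sup>*\<close>. Its
  second term cancels \<open>G \<delta>\<close>, so that
  \<open>G \<delta> + \<langle>G \<delta>, \<delta>\<rangle> w\<close> is a multiple of
  \<open>\<gamma>\<close>; the square root is the normalisation for which the updated operator maps
  \<open>\<delta>\<close> exactly to \<open>\<gamma>\<close>.\<close>

definition bfgs_factor ::
    "('a::real_normed_vector \<Rightarrow> ('a \<Rightarrow>\<^sub>L real)) \<Rightarrow> 'a \<Rightarrow> ('a \<Rightarrow>\<^sub>L real) \<Rightarrow> ('a \<Rightarrow>\<^sub>L real)" where
  "bfgs_factor G \<delta> \<gamma> = (1 / sqrt (\<langle>G \<delta>, \<delta>\<rangle> * \<langle>\<gamma>, \<delta>\<rangle>)) *\<^sub>R \<gamma> - (1 / \<langle>G \<delta>, \<delta>\<rangle>) *\<^sub>R G \<delta>"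

text \<open>The update is a congruence \<open>F\<^sup>* G F\<close> with \<open>F = I + \<delta> w\<^sup>*\<close>.\<close>

lemma
  assumes G: "spd_op G" and p: "0 < \<langle>\<gamma>, \<delta>\<rangle>"
  defines "w \<equiv> bfgs_factor G \<delta> \<gamma>"
  shows bfgs_direct_congruence:
      "bfgs_direct G \<delta> \<gamma> u = G (u + \<langle>w, u\<rangle> *\<^sub>R \<delta>) + \<langle>G (u + \<langle>w, u\<rangle> *\<^sub>R \<delta>), \<delta>\<rangle> *\<^sub>R w"
    and bfgs_factor_pos: "0 < 1 + \<langle>w, \<delta>\<rangle>"
    and bfgs_factor_power2: "(1 + \<langle>w, \<delta>\<rangle>)\<^sup>2 = \<langle>\<gamma>, \<delta>\<rangle> / \<langle>G \<delta>, \<delta>\<rangle>"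
proof -
  interpret linear G by (rule spd_opD(1)[OF G])
  let ?q = "\<langle>G \<delta>, \<delta>\<rangle>" and ?p = "\<langle>\<gamma>, \<delta>\<rangle>"
  define z where "z = sqrt (?q * ?p)"
  have "\<delta> \<noteq> 0" using p by auto
  then have q: "0 < ?q" by (rule spd_opD(3)[OF G])
  have z: "0 < z" "z * z = ?q * ?p" using p q by (simp_all add: z_def)
  have w: "\<langle>w, u\<rangle> = \<langle>\<gamma>, u\<rangle> / z - \<langle>G \<delta>, u\<rangle> / ?q" for u
    by (simp add: w_def bfgs_factor_def z_def blinfun.diff_left blinfun.scaleR_left)
  have e: "1 + \<langle>w, \<delta>\<rangle> = ?p / z" using q by (simp add: w)
  show "0 < 1 + \<langle>w, \<delta>\<rangle>" unfolding e using p z by simp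
  show "(1 + \<langle>w, \<delta>\<rangle>)\<^sup>2 = ?p / ?q"
    unfolding e using p q z by (simp add: power_divide power2_eq_square)
  show "bfgs_direct G \<delta> \<gamma> u = G (u + \<langle>w, u\<rangle> *\<^sub>R \<delta>) + \<langle>G (u + \<langle>w, u\<rangle> *\<^sub>R \<delta>), \<delta>\<rangle> *\<^sub>R w"
  proof (rule blinfun_eqI)
    fix v
    have s: "\<langle>G u, \<delta>\<rangle> = \<langle>G \<delta>, u\<rangle>" by (rule spd_opD(2)[OF G])
    let ?e = "\<langle>G \<delta>, u\<rangle>" and ?g = "\<langle>\<gamma>, u\<rangle>" and ?ev = "\<langle>G \<delta>, v\<rangle>" and ?gv = "\<langle>\<gamma>, v\<rangle>"
    have "\<langle>G (u + \<langle>w, u\<rangle> *\<^sub>R \<delta>) + \<langle>G (u + \<langle>w, u\<rangle> *\<^sub>R \<delta>), \<delta>\<rangle> *\<^sub>R w, v\<rangle>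
        = \<langle>G u, v\<rangle> + (?g / z - ?e / ?q) * ?ev + (?e + (?g / z - ?e / ?q) * ?q) * (?gv / z - ?ev / ?q)"
      by (simp add: add scale blinfun.add_left blinfun.scaleR_left w s)
    also have "?e + (?g / z - ?e / ?q) * ?q = ?q * ?g / z" using q by (simp add: field_simps)
    also have "\<langle>G u, v\<rangle> + (?g / z - ?e / ?q) * ?ev + (?q * ?g / z) * (?gv / z - ?ev / ?q)
        = \<langle>G u, v\<rangle> - ?e / ?q * ?ev + (?q * ?g * ?gv) / (z * z)"
      using q z(1) by (simp add: field_simps)
    also have "(?q * ?g * ?gv) / (z * z) = ?g / ?p * ?gv" unfolding z using p q by simp
    finally show "\<langle>bfgs_direct G \<delta> \<gamma> u, v\<rangle>
        = \<langle>G (u + \<langle>w, u\<rangle> *\<^sub>R \<delta>) + \<langle>G (u + \<langle>w, u\<rangle> *\<^sub>R \<delta>), \<delta>\<rangle> *\<^sub>R w, v\<rangle>"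
      by (simp add: bfgs_direct_def blinfun.add_left blinfun.diff_left blinfun.scaleR_left)
  qed
qed

text \<open>Positivity passes along the congruence because its factor is injective: if
  \<open>u + \<langle>w, u\<rangle> \<delta>\<close> vanishes, then so does
  \<open>\<langle>w, u\<rangle> (1 + \<langle>w, \<delta>\<rangle>)\<close>, and the second factor
  is positive.\<close>

lemma spd_bfgs_direct:
  assumes G: "spd_op G" and p: "0 < \<langle>\<gamma>, \<delta>\<rangle>"
  shows "spd_op (bfgs_direct G \<delta> \<gamma>)"
  unfolding spd_op_def
proof (intro conjI allI impI)
  interpret linear G by (rule spd_opD(1)[OF G])
  let ?w = "bfgs_factor G \<delta> \<gamma>"
  show "linear (bfgs_direct G \<delta> \<gamma>)"
    by (rule linearI) (simp_all add: bfgs_direct_def add scale blinfun.add_right blinfun.scaleR_right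
        add_divide_distrib scaleR_add_left scaleR_add_right scaleR_diff_right)
  show "\<langle>bfgs_direct G \<delta> \<gamma> u, v\<rangle> = \<langle>bfgs_direct G \<delta> \<gamma> v, u\<rangle>" for u v
    using spd_opD(2)[OF G, of u v]
    by (simp add: bfgs_direct_def blinfun.add_left blinfun.diff_left blinfun.scaleR_left mult.commute)
  fix u :: 'a assume u: "u \<noteq> 0"
  let ?y = "u + \<langle>?w, u\<rangle> *\<^sub>R \<delta>"
  have "?y \<noteq> 0"
  proof
    assume 0: "?y = 0"
    have "\<langle>?w, u\<rangle> * (1 + \<langle>?w, \<delta>\<rangle>) = \<langle>?w, ?y\<rangle>"
      by (simp add: blinfun.add_right blinfun.scaleR_right distrib_left)
    also have "\<dots> = 0" by (simp add: 0)
    finally have "\<langle>?w, u\<rangle> = 0" using bfgs_factor_pos[OF G p] by simp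
    then show False using 0 u by simp
  qed
  then have "0 < \<langle>G ?y, ?y\<rangle>" by (rule spd_opD(3)[OF G])
  also have "\<dots> = \<langle>bfgs_direct G \<delta> \<gamma> u, u\<rangle>"
    unfolding bfgs_direct_congruence[OF G p]
    by (simp add: blinfun.add_left blinfun.add_right blinfun.scaleR_left blinfun.scaleR_right algebra_simps)
  finally show "0 < \<langle>bfgs_direct G \<delta> \<gamma> u, u\<rangle>" .
qed

text \<open>A left inverse suffices, since the updated operator is bijective. In the composition the
  multiples of \<open>inv G \<gamma>\<close> cancel, and those of \<open>\<delta>\<close> collect
  into a single coefficient that vanishes.\<close>

lemma bfgs_update_inverse:
  fixes G :: "'a::euclidean_space \<Rightarrow> ('a \<Rightarrow>\<^sub>L real)"
  assumes G: "spd_op G" and p: "0 < \<langle>\<gamma>, \<delta>\<rangle>"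
  shows "bfgs_update (inv G) \<delta> \<gamma> = inv (bfgs_direct G \<delta> \<gamma>)"
proof -
  let ?G' = "bfgs_direct G \<delta> \<gamma>" and ?H' = "bfgs_update (inv G) \<delta> \<gamma>"
  note G' = spd_bfgs_direct[OF G p]
  interpret i: linear "inv G" by (rule spd_op_linear_inv[OF G])
  have q: "0 < \<langle>G \<delta>, \<delta>\<rangle>" using p by (intro spd_opD(3)[OF G]) auto
  have "?H' (?G' u) = u" for u
  proof -
    let ?e = "\<langle>G \<delta>, u\<rangle>" and ?g = "\<langle>\<gamma>, u\<rangle>" and ?q = "\<langle>G \<delta>, \<delta>\<rangle>" and ?p = "\<langle>\<gamma>, \<delta>\<rangle>"
    let ?a = "\<langle>\<gamma>, inv G \<gamma>\<rangle>"
    have 1: "\<langle>?G' u, \<delta>\<rangle> = ?g"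
      using p q spd_opD(2)[OF G, of u \<delta>]
      by (simp add: bfgs_direct_def blinfun.add_left blinfun.diff_left blinfun.scaleR_left)
    have 2: "inv G (?G' u) = u - (?e / ?q) *\<^sub>R \<delta> + (?g / ?p) *\<^sub>R inv G \<gamma>"
      using G by (simp add: bfgs_direct_def i.add i.diff i.scale)
    have 3: "\<langle>\<gamma>, inv G (?G' u)\<rangle> = ?g - (?e / ?q) * ?p + (?g / ?p) * ?a"
      unfolding 2 by (simp add: blinfun.add_right blinfun.diff_right blinfun.scaleR_right)
    have "?H' (?G' u) = u + (- (?e / ?q) - (1 / ?p) * (?g - (?e / ?q) * ?p + (?g / ?p) * ?a)
        + ((?a / ?p + 1) * (1 / ?p)) * ?g) *\<^sub>R \<delta>"
      unfolding bfgs_update_def 1 3 unfolding 2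
      by (simp add: scaleR_add_left scaleR_diff_left scaleR_add_right scaleR_diff_right
          add_divide_distrib diff_divide_distrib algebra_simps)
    also have "- (?e / ?q) - (1 / ?p) * (?g - (?e / ?q) * ?p + (?g / ?p) * ?a)
        + ((?a / ?p + 1) * (1 / ?p)) * ?g = 0"
      using p q by (simp add: field_simps)
    finally show ?thesis by simp
  qed
  from this[of "inv ?G' _"] show ?thesis by (simp add: G' fun_eq_iff)
qed

section \<open>Determinant and potential under one update\<close>

lemma spd_op_linear_inv_comp:
  fixes A :: "'a::euclidean_space \<Rightarrow> ('a \<Rightarrow>\<^sub>L real)"
  assumes "spd_op A" "spd_op G"
  shows "linear (\<lambda>u. inv A (G u))"
  using linear_compose[OF spd_opD(1)[OF assms(2)] spd_op_linear_inv[OF assms(1)]] by (simp add: o_def)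

text \<open>The congruence factors the new endomorphism as \<open>K\<close>, the old one, and
  \<open>F\<close>, where \<open>K\<close> is the adjoint of \<open>F\<close> with respect to
  \<open>A\<close>. Both are rank-one perturbations of the identity with determinant
  \<open>1 + \<langle>w, \<delta>\<rangle>\<close>, whose square is the quotient in the
  claim.\<close>

lemma det_bfgs_direct:
  fixes A :: "'a::euclidean_space \<Rightarrow> ('a \<Rightarrow>\<^sub>L real)"
  assumes A: "spd_op A" and G: "spd_op G" and p: "0 < \<langle>\<gamma>, \<delta>\<rangle>"
  shows "det (endo_matrix (\<lambda>u. inv A (bfgs_direct G \<delta> \<gamma> u)))
    = \<langle>\<gamma>, \<delta>\<rangle> / \<langle>G \<delta>, \<delta>\<rangle> * det (endo_matrix (\<lambda>u. inv A (G u)))"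
proof -
  define w where "w = bfgs_factor G \<delta> \<gamma>"
  define F where "F u = u + \<langle>w, u\<rangle> *\<^sub>R \<delta>" for u
  define K where "K u = u + \<langle>A \<delta>, u\<rangle> *\<^sub>R inv A w" for u
  interpret i: linear "inv A" by (rule spd_op_linear_inv[OF A])
  have linK: "linear K"
    unfolding K_def by (rule linearI) (simp_all add: blinfun.add_right blinfun.scaleR_right scaleR_add_left scaleR_add_right)
  have "inv A (s + \<langle>s, \<delta>\<rangle> *\<^sub>R w) = K (inv A s)" for s
    using spd_opD(2)[OF A, of \<delta> "inv A s"] A by (simp add: K_def i.add i.scale)
  then have "inv A (bfgs_direct G \<delta> \<gamma> u) = K (inv A (G (F u)))" for u
    unfolding bfgs_direct_congruence[OF G p] F_def w_def by simp
  then have "endo_matrix (\<lambda>u. inv A (bfgs_direct G \<delta> \<gamma> u))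
      = endo_matrix K ** (endo_matrix (\<lambda>u. inv A (G u)) ** endo_matrix F)"
    by (simp add: endo_matrix_comp[OF linK, of "\<lambda>u. inv A (G (F u))"]
        endo_matrix_comp[OF spd_op_linear_inv_comp[OF A G], of F])
  moreover have "det (endo_matrix F) = 1 + \<langle>w, \<delta>\<rangle>"
    unfolding F_def by (rule det_endo_matrix_rank_one)
  moreover have "det (endo_matrix K) = 1 + \<langle>w, \<delta>\<rangle>"
    unfolding K_def using det_endo_matrix_rank_one[of "A \<delta>" "inv A w"] spd_opD(2)[OF A, of \<delta> "inv A w"] A
    by simp
  ultimately show ?thesis
    by (simp add: det_mul bfgs_factor_power2[OF G p, symmetric] power2_eq_square w_def)
qed

text \<open>The exact decrease of \<open>psi A\<close> when \<open>G\<close> is updated along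
  \<open>u\<close> with the curvature \<open>A u\<close> in place of \<gamma>. It has the form
  \<open>a - 1 - ln b\<close> with \<open>b \<le> a\<close>.\<close>

definition discrepancy ::
    "('a::real_normed_vector \<Rightarrow> ('a \<Rightarrow>\<^sub>L real)) \<Rightarrow> ('a \<Rightarrow> ('a \<Rightarrow>\<^sub>L real)) \<Rightarrow> 'a \<Rightarrow> real" where
  "discrepancy A G u = \<langle>G u, inv A (G u)\<rangle> / \<langle>G u, u\<rangle> - 1 - ln (\<langle>G u, u\<rangle> / \<langle>A u, u\<rangle>)"

text \<open>The trace is linear and the determinant multiplicative. Inserting
  \<open>ln \<langle>A \<delta>, \<delta>\<rangle>\<close> with both signs separates a part that
  depends on \<open>G\<close> only from a part that measures how far \<gamma> is from
  \<open>A \<delta>\<close> and vanishes when they agree.\<close>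

lemma psi_bfgs_direct:
  fixes A :: "'a::euclidean_space \<Rightarrow> ('a \<Rightarrow>\<^sub>L real)"
  assumes A: "spd_op A" and G: "spd_op G" and p: "0 < \<langle>\<gamma>, \<delta>\<rangle>"
    and det: "0 < det (endo_matrix (\<lambda>u. inv A (G u)))"
  shows "psi A (bfgs_direct G \<delta> \<gamma>) = psi A G - discrepancy A G \<delta>
    + (\<langle>\<gamma>, inv A \<gamma>\<rangle> / \<langle>\<gamma>, \<delta>\<rangle> - 1 - ln (\<langle>\<gamma>, \<delta>\<rangle> / \<langle>A \<delta>, \<delta>\<rangle>))"
proof -
  interpret i: linear "inv A" by (rule spd_op_linear_inv[OF A])
  let ?q = "\<langle>G \<delta>, \<delta>\<rangle>" and ?p = "\<langle>\<gamma>, \<delta>\<rangle>" and ?D = "\<langle>A \<delta>, \<delta>\<rangle>"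
  have "\<delta> \<noteq> 0" using p by auto
  then have q: "0 < ?q" and D: "0 < ?D" using spd_opD(3) A G by blast+
  have "inv A (bfgs_direct G \<delta> \<gamma> u - A u) = inv A (G u - A u) 
      + (\<langle>G \<delta>, u\<rangle> *\<^sub>R ((- 1 / ?q) *\<^sub>R inv A (G \<delta>)) + \<langle>\<gamma>, u\<rangle> *\<^sub>R ((1 / ?p) *\<^sub>R inv A \<gamma>))" for u
    by (simp add: bfgs_direct_def i.add i.diff i.scale)
  then have "trace (endo_matrix (\<lambda>u. inv A (bfgs_direct G \<delta> \<gamma> u - A u)))
      = trace (endo_matrix (\<lambda>u. inv A (G u - A u))) - \<langle>G \<delta>, inv A (G \<delta>)\<rangle> / ?q + \<langle>\<gamma>, inv A \<gamma>\<rangle> / ?p"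
    by (simp only: endo_matrix_add trace_add trace_endo_matrix_rank_one blinfun.scaleR_right) simp
  moreover have "ln (det (endo_matrix (\<lambda>u. inv A (bfgs_direct G \<delta> \<gamma> u))))
      = ln ?p - ln ?q + ln (det (endo_matrix (\<lambda>u. inv A (G u))))"
    unfolding det_bfgs_direct[OF A G p] using p q det by (simp add: ln_mult_pos ln_divide_pos)
  ultimately show ?thesis
    using p q D by (simp add: psi_def discrepancy_def ln_divide_pos)
qed

lemma dual_pairing_pos:
  fixes A :: "'a::euclidean_space \<Rightarrow> ('a \<Rightarrow>\<^sub>L real)"
  assumes A: "spd_op A" and "s \<noteq> 0"
  shows "0 < \<langle>s, inv A s\<rangle>"
proof -
  have "inv A s \<noteq> 0"
    using assms spd_op_inv(1)[OF A, of s] linear_0[OF spd_opD(1)[OF A]] by metis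
  then show ?thesis using spd_opD(3)[OF A, of "inv A s"] A by simp
qed

text \<open>Cauchy-Schwarz for \<open>inv A s\<close> and \<open>u\<close>. For
  \<open>s = G u\<close> it compares the two quotients in \<open>discrepancy\<close>, so that the
  smaller one alone gives a lower bound.\<close>

lemma ratio_cauchy:
  fixes A :: "'a::euclidean_space \<Rightarrow> ('a \<Rightarrow>\<^sub>L real)"
  assumes A: "spd_op A" and u: "0 < \<langle>s, u\<rangle>"
  shows "\<langle>s, u\<rangle> / \<langle>A u, u\<rangle> \<le> \<langle>s, inv A s\<rangle> / \<langle>s, u\<rangle>"
proof -
  have "0 < \<langle>A u, u\<rangle>" using u by (intro spd_opD(3)[OF A]) auto
  moreover have "\<langle>s, u\<rangle>\<^sup>2 \<le> \<langle>s, inv A s\<rangle> * \<langle>A u, u\<rangle>"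
    using spd_op_cauchy[OF A, of "inv A s" u] A by simp
  ultimately show ?thesis using u by (simp add: field_simps power2_eq_square)
qed

lemma discrepancy_ge:
  fixes A :: "'a::euclidean_space \<Rightarrow> ('a \<Rightarrow>\<^sub>L real)"
  assumes A: "spd_op A" and G: "spd_op G" and u: "u \<noteq> 0"
  shows "\<langle>G u, u\<rangle> / \<langle>A u, u\<rangle> - 1 - ln (\<langle>G u, u\<rangle> / \<langle>A u, u\<rangle>) \<le> discrepancy A G u"
  using ratio_cauchy[OF A spd_opD(3)[OF G u]] by (simp add: discrepancy_def)

lemma discrepancy_nonneg:
  fixes A :: "'a::euclidean_space \<Rightarrow> ('a \<Rightarrow>\<^sub>L real)"
  assumes A: "spd_op A" and G: "spd_op G" and u: "u \<noteq> 0"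
  shows "0 \<le> discrepancy A G u"
proof -
  have "0 < \<langle>G u, u\<rangle> / \<langle>A u, u\<rangle>" using spd_opD(3)[OF G u] spd_opD(3)[OF A u] by simp
  from ln_le_minus_one[OF this] show ?thesis using discrepancy_ge[OF assms] by linarith
qed

text \<open>
  Updating along directions that are conjugate with respect to \<open>A\<close>, with exact curvature
  \<open>\<gamma> = A \<delta>\<close>, turns \<open>G\<close> into \<open>A\<close> in finitely many steps, and \<open>\<psi>(A, \<cdot>)\<close> decreases at each of them
  down to \<open>\<psi>(A, A) = 0\<close>.
\<close>

lemma spd_det_pos_psi_nonneg:
  fixes A :: "'a::euclidean_space \<Rightarrow> ('a \<Rightarrow>\<^sub>L real)"
  assumes A: "spd_op A" and "spd_op G"
  shows "0 < det (endo_matrix (\<lambda>u. inv A (G u))) \<and> 0 \<le> psi A G"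
  using assms(2)
\<comment> \<open>The measure is the codimension of the subspace on which \<open>G\<close> and
  \<open>A\<close> agree. This replaces the usual argument by the eigenvalues of
  \<open>inv A\<close> composed with \<open>G\<close>.\<close>
proof (induction "DIM('a) - dim {u. G u = A u}" arbitrary: G rule: less_induct)
  case less
  note G = less.prems
  interpret A: linear A by (rule spd_opD(1)[OF A])
  interpret G: linear G by (rule spd_opD(1)[OF G])
  let ?V = "{u. G u = A u}"
  have V: "subspace ?V" by (auto simp: subspace_def A.add G.add A.scale G.scale)
  show ?case
  proof (cases "dim ?V = DIM('a)")
    case True
    then have "?V = UNIV" using V by (simp add: dim_eq_full span_eq_iff[THEN iffD2])
    then have "G = A" by (auto simp: fun_eq_iff)
    moreover have "trace (endo_matrix (\<lambda>u. 0 :: 'a)) = 0"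
      by (simp add: trace_def endo_matrix_def)
    moreover have "inv A 0 = 0" using spd_op_linear_inv[OF A] by (rule linear_0)
    ultimately show ?thesis using A by (simp add: psi_def endo_matrix_id)
  next
    case False
    then have less_dim: "dim ?V < DIM('a)" using dim_subset_UNIV[of ?V] by linarith
    then obtain z where z: "z \<noteq> 0" "\<And>y. y \<in> span ?V \<Longrightarrow> orthogonal z y"
      using orthogonal_to_subspace_exists[of ?V] by blast
    \<comment> \<open>As \<open>A \<delta>\<close> is the inner product with \<open>z\<close>, the
      vector \<delta> is conjugate to the whole subspace of agreement: the update leaves
      \<open>G\<close> unchanged there and adds the new direction \<delta>.\<close>
    define \<delta> where "\<delta> = inv A (blinfun_inner_right z)"
    have A\<delta>: "A \<delta> = blinfun_inner_right z" using A by (simp add: \<delta>_def)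
    have conj: "\<langle>A \<delta>, v\<rangle> = 0" if "G v = A v" for v
      using z(2)[of v] that by (simp add: A\<delta> orthogonal_def span_base)
    have "\<delta> \<noteq> 0"
    proof
      assume "\<delta> = 0"
      then have "\<langle>blinfun_inner_right z, z\<rangle> = 0" using A\<delta> A.zero by simp
      then show False using z(1) by simp
    qed
    then have D: "0 < \<langle>A \<delta>, \<delta>\<rangle>" and q: "0 < \<langle>G \<delta>, \<delta>\<rangle>" using spd_opD(3) A G by blast+
    let ?G' = "bfgs_direct G \<delta> (A \<delta>)"
    note G' = spd_bfgs_direct[OF G D]
    have "\<delta> \<notin> ?V" using conj[of \<delta>] D by auto
    moreover have sub: "insert \<delta> ?V \<subseteq> {u. ?G' u = A u}"
    proof -
      have "?G' \<delta> = A \<delta>" using D q by (simp add: bfgs_direct_def)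
      moreover have "?G' v = A v" if v: "G v = A v" for v
      proof -
        have "\<langle>G \<delta>, v\<rangle> = \<langle>A \<delta>, v\<rangle>"
          using spd_opD(2)[OF G, of \<delta> v] spd_opD(2)[OF A, of \<delta> v] v by simp
        then show ?thesis using conj[OF v] v by (simp add: bfgs_direct_def)
      qed
      ultimately show ?thesis by auto
    qed
    ultimately have "dim ?V < dim {u. ?G' u = A u}"
      using dim_subset[OF sub] V by (simp add: dim_insert span_eq_iff[THEN iffD2])
    then have "DIM('a) - dim {u. ?G' u = A u} < DIM('a) - dim ?V" using less_dim by linarith
    from less.hyps[OF this G'] have IH: "0 < det (endo_matrix (\<lambda>u. inv A (?G' u)))" "0 \<le> psi A ?G'" by auto
    \<comment> \<open>The determinant formula is read backwards: the updated determinant and the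
      factor are positive, hence so is the old determinant.\<close>
    from IH(1) have det: "0 < det (endo_matrix (\<lambda>u. inv A (G u)))"
      unfolding det_bfgs_direct[OF A G D] using D q by (simp add: zero_less_mult_iff zero_less_divide_iff)
    have "psi A ?G' = psi A G - discrepancy A G \<delta>"
      using psi_bfgs_direct[OF A G D det] A D by simp
    then show ?thesis using det IH(2) discrepancy_nonneg[OF A G \<open>\<delta> \<noteq> 0\<close>] by linarith
  qed
qed

text \<open>Since \<delta> is a multiple of the search direction, the decrease of the potential does
  not depend on the step size.\<close>

lemma discrepancy_scaleR:
  fixes A :: "'a::euclidean_space \<Rightarrow> ('a \<Rightarrow>\<^sub>L real)"
  assumes A: "spd_op A" and G: "spd_op G" and "a \<noteq> 0"
  shows "discrepancy A G (a *\<^sub>R u) = discrepancy A G u"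
  using assms(3) linear_scale[OF spd_opD(1)[OF A]] linear_scale[OF spd_opD(1)[OF G]]
    linear_scale[OF spd_op_linear_inv[OF A]]
  by (simp add: discrepancy_def blinfun.scaleR_left blinfun.scaleR_right)

section \<open>Strongly convex functions with Lipschitz Hessian\<close>

locale strongly_convex_objective =
  fixes B :: "'a::euclidean_space \<Rightarrow> ('a \<Rightarrow>\<^sub>L real)"
    and f :: "'a \<Rightarrow> real"
    and grad :: "'a \<Rightarrow> ('a \<Rightarrow>\<^sub>L real)"
    and hess :: "'a \<Rightarrow> 'a \<Rightarrow> ('a \<Rightarrow>\<^sub>L real)"
    and \<mu> L\<^sub>2 :: real
    and xmin :: 'a
  assumes B: "spd_op B"
    and mu_pos: "0 < \<mu>" and L2_nonneg: "0 \<le> L\<^sub>2"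
    and gradient: "\<And>y. (f has_derivative blinfun_apply (grad y)) (at y)"
    and hessian: "\<And>y. (grad has_derivative hess y) (at y)"
    and strongly_convex: "\<And>y z. \<langle>grad y - grad z, y - z\<rangle> \<ge> \<mu> * (primal_norm B (y - z))\<^sup>2"
    and lipschitz_hessian:
      "\<And>y z. op_norm B (\<lambda>u. hess y u - hess z u) \<le> L\<^sub>2 * primal_norm B (y - z)"
    and minimizer: "\<And>y. f xmin \<le> f y"
begin

abbreviation "A \<equiv> hess xmin"

section \<open>Derivatives along lines, bounds and symmetry of the Hessian\<close>

lemma linear_hess: "linear (hess y)"
  using hessian by (rule has_derivative_linear)

lemma DERIV_along:
  "((\<lambda>\<tau>. f (z + \<tau> *\<^sub>R e)) has_real_derivative \<langle>grad (z + \<tau> *\<^sub>R e), e\<rangle>) (at \<tau>)"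
proof -
  have "((\<lambda>\<tau>. z + \<tau> *\<^sub>R e) has_derivative (\<lambda>h. h *\<^sub>R e)) (at \<tau>)"
    by (auto intro!: derivative_eq_intros)
  from has_derivative_compose[OF this gradient] show ?thesis
    by (simp add: has_field_derivative_def blinfun.scaleR_right mult_commute_abs)
qed

lemma DERIV_grad_along:
  "((\<lambda>\<tau>. \<langle>grad (z + \<tau> *\<^sub>R e), v\<rangle>) has_real_derivative \<langle>hess (z + \<tau> *\<^sub>R e) e, v\<rangle>) (at \<tau>)"
proof -
  have "((\<lambda>\<tau>. z + \<tau> *\<^sub>R e) has_derivative (\<lambda>h. h *\<^sub>R e)) (at \<tau>)"
    by (auto intro!: derivative_eq_intros)
  from has_derivative_compose[OF this hessian]
  have "((\<lambda>\<tau>. grad (z + \<tau> *\<^sub>R e)) has_derivative (\<lambda>h. h *\<^sub>R hess (z + \<tau> *\<^sub>R e) e)) (at \<tau>)"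
    by (simp add: linear_scale[OF linear_hess])
  from blinfun.FDERIV[OF this has_derivative_const]
  have "((\<lambda>\<tau>. \<langle>grad (z + \<tau> *\<^sub>R e), v\<rangle>) has_derivative (\<lambda>h. h * \<langle>hess (z + \<tau> *\<^sub>R e) e, v\<rangle>)) (at \<tau>)"
    by (simp add: blinfun.scaleR_left)
  then show ?thesis by (simp add: has_field_derivative_def mult_commute_abs)
qed

lemma hess_lipschitz:
  "\<bar>\<langle>hess y u - hess z u, v\<rangle>\<bar> \<le> L\<^sub>2 * primal_norm B (y - z) * primal_norm B u * primal_norm B v"
proof -
  have "linear (\<lambda>u. hess y u - hess z u)" by (intro linear_compose_sub linear_hess)
  from op_norm_bound[OF B this, of u v]
  have "\<bar>\<langle>hess y u - hess z u, v\<rangle>\<bar>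
      \<le> op_norm B (\<lambda>u. hess y u - hess z u) * (primal_norm B u * primal_norm B v)"
    by (simp add: mult.assoc)
  also have "\<dots> \<le> (L\<^sub>2 * primal_norm B (y - z)) * (primal_norm B u * primal_norm B v)"
    by (intro mult_right_mono lipschitz_hessian) (simp add: B)
  finally show ?thesis by (simp add: mult.assoc)
qed

text \<open>Strong convexity bounds the difference quotients of the gradient along \<open>u\<close>;
  dividing by \<open>h > 0\<close> keeps the inequality, hence the right-sided limit.\<close>

lemma hess_ge: "\<mu> * \<langle>B u, u\<rangle> \<le> \<langle>hess y u, u\<rangle>"
proof -
  let ?\<phi> = "\<lambda>\<tau>. \<langle>grad (y + \<tau> *\<^sub>R u), u\<rangle>"
  have "((\<lambda>h. (?\<phi> (0 + h) - ?\<phi> 0) / h) \<longlongrightarrow> \<langle>hess y u, u\<rangle>) (at 0)"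
    using DERIV_grad_along[of y u u 0] unfolding DERIV_def by simp
  then have lim: "((\<lambda>h. (?\<phi> (0 + h) - ?\<phi> 0) / h) \<longlongrightarrow> \<langle>hess y u, u\<rangle>) (at_right 0)"
    by (rule tendsto_within_subset) simp
  have "\<mu> * \<langle>B u, u\<rangle> \<le> (?\<phi> (0 + h) - ?\<phi> 0) / h" if "0 < h" for h
  proof -
    have "\<mu> * (h\<^sup>2 * \<langle>B u, u\<rangle>) \<le> h * (?\<phi> h - ?\<phi> 0)"
      using strongly_convex[of "y + h *\<^sub>R u" y] unfolding primal_norm_power2[OF B]
      by (simp add: blinfun.scaleR_right blinfun.diff_left blinfun.scaleR_left
          linear_scale[OF spd_opD(1)[OF B]] power2_eq_square)
    then have "h * (\<mu> * \<langle>B u, u\<rangle> * h) \<le> h * (?\<phi> h - ?\<phi> 0)" by (simp add: power2_eq_square mult_ac)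
    then show ?thesis using that by (simp add: pos_le_divide_eq)
  qed
  then have "eventually (\<lambda>h. \<mu> * \<langle>B u, u\<rangle> \<le> (?\<phi> (0 + h) - ?\<phi> 0) / h) (at_right 0)"
    by (simp add: eventually_at_right_less eventually_mono[OF eventually_at_right_less])
  from tendsto_lowerbound[OF lim this] show ?thesis by simp
qed

lemma second_difference:
  assumes "0 < s"
  obtains a b where "0 < a" "a < s" "0 < b" "b < s"
    "f (y + s *\<^sub>R u + s *\<^sub>R v) - f (y + s *\<^sub>R u) - f (y + s *\<^sub>R v) + f y
      = s\<^sup>2 * \<langle>hess (y + a *\<^sub>R v + b *\<^sub>R u) u, v\<rangle>"
proof -
  let ?\<phi> = "\<lambda>\<tau>. f (y + s *\<^sub>R u + \<tau> *\<^sub>R v) - f (y + \<tau> *\<^sub>R v)"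
  have "\<exists>a>0. a < s \<and> ?\<phi> s - ?\<phi> 0
      = (s - 0) * (\<langle>grad (y + s *\<^sub>R u + a *\<^sub>R v), v\<rangle> - \<langle>grad (y + a *\<^sub>R v), v\<rangle>)"
    by (rule MVT2[OF assms]) (intro DERIV_diff DERIV_along)
  then obtain a where a: "0 < a" "a < s"
    "?\<phi> s - ?\<phi> 0 = s * (\<langle>grad (y + s *\<^sub>R u + a *\<^sub>R v), v\<rangle> - \<langle>grad (y + a *\<^sub>R v), v\<rangle>)" by auto
  let ?\<chi> = "\<lambda>\<tau>. \<langle>grad (y + a *\<^sub>R v + \<tau> *\<^sub>R u), v\<rangle>"
  have "\<exists>b>0. b < s \<and> ?\<chi> s - ?\<chi> 0 = (s - 0) * \<langle>hess (y + a *\<^sub>R v + b *\<^sub>R u) u, v\<rangle>"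
    by (rule MVT2[OF assms]) (intro DERIV_grad_along)
  then obtain b where b: "0 < b" "b < s"
    "?\<chi> s - ?\<chi> 0 = s * \<langle>hess (y + a *\<^sub>R v + b *\<^sub>R u) u, v\<rangle>" by auto
  have "?\<phi> s - ?\<phi> 0 = s\<^sup>2 * \<langle>hess (y + a *\<^sub>R v + b *\<^sub>R u) u, v\<rangle>"
    using a(3) b(3) by (simp add: power2_eq_square algebra_simps)
  then show thesis using that[OF a(1,2) b(1,2)] by simp
qed

text \<open>The second difference of \<open>f\<close> is symmetric in \<open>u\<close> and
  \<open>v\<close>, and \<open>second_difference\<close> evaluates it in both orders by Hessians at
  points near \<open>y\<close>. By the Lipschitz bound these differ from the Hessian at
  \<open>y\<close> by a multiple of \<open>s\<close>, which is arbitrarily small.\<close>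

lemma hess_sym: "\<langle>hess y u, v\<rangle> = \<langle>hess y v, u\<rangle>"
proof (rule ccontr)
  assume neq: "\<langle>hess y u, v\<rangle> \<noteq> \<langle>hess y v, u\<rangle>"
  define K where "K = L\<^sub>2 * (primal_norm B u + primal_norm B v) * primal_norm B u * primal_norm B v"
  have near: "\<bar>\<langle>hess (y + a *\<^sub>R q + b *\<^sub>R p) p, q\<rangle> - \<langle>hess y p, q\<rangle>\<bar>
      \<le> s * (L\<^sub>2 * (primal_norm B p + primal_norm B q) * primal_norm B p * primal_norm B q)"
    if "0 < a" "a < s" "0 < b" "b < s" for a b s p q
  proof -
    have "\<bar>\<langle>hess (y + a *\<^sub>R q + b *\<^sub>R p) p, q\<rangle> - \<langle>hess y p, q\<rangle>\<bar>
        \<le> L\<^sub>2 * primal_norm B (a *\<^sub>R q + b *\<^sub>R p) * primal_norm B p * primal_norm B q"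
      using hess_lipschitz[of "y + a *\<^sub>R q + b *\<^sub>R p" p y q] by (simp add: blinfun.diff_left add.assoc)
    also have "\<dots> \<le> L\<^sub>2 * (s * (primal_norm B p + primal_norm B q)) * primal_norm B p * primal_norm B q"
    proof (intro mult_right_mono mult_left_mono)
      have "primal_norm B (a *\<^sub>R q + b *\<^sub>R p) \<le> a * primal_norm B q + b * primal_norm B p"
        using primal_norm_triangle[OF B, of "a *\<^sub>R q" "b *\<^sub>R p"] that B by (simp add: primal_norm_scaleR)
      also have "\<dots> \<le> s * primal_norm B q + s * primal_norm B p"
        using that B by (intro add_mono mult_right_mono) auto
      finally show "primal_norm B (a *\<^sub>R q + b *\<^sub>R p) \<le> s * (primal_norm B p + primal_norm B q)"
        by (simp add: algebra_simps)
    qed (use B L2_nonneg in auto)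
    finally show ?thesis by (simp add: mult_ac)
  qed
  have K: "\<bar>\<langle>hess y u, v\<rangle> - \<langle>hess y v, u\<rangle>\<bar> \<le> 2 * (s * K)" if "0 < s" for s
  proof -
    obtain a b where ab: "0 < a" "a < s" "0 < b" "b < s"
      "f (y + s *\<^sub>R u + s *\<^sub>R v) - f (y + s *\<^sub>R u) - f (y + s *\<^sub>R v) + f y
        = s\<^sup>2 * \<langle>hess (y + a *\<^sub>R v + b *\<^sub>R u) u, v\<rangle>" using second_difference[OF \<open>0 < s\<close>] .
    obtain a' b' where ab': "0 < a'" "a' < s" "0 < b'" "b' < s"
      "f (y + s *\<^sub>R v + s *\<^sub>R u) - f (y + s *\<^sub>R v) - f (y + s *\<^sub>R u) + f y
        = s\<^sup>2 * \<langle>hess (y + a' *\<^sub>R u + b' *\<^sub>R v) v, u\<rangle>" using second_difference[OF \<open>0 < s\<close>] .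
    have "s\<^sup>2 * \<langle>hess (y + a *\<^sub>R v + b *\<^sub>R u) u, v\<rangle> = s\<^sup>2 * \<langle>hess (y + a' *\<^sub>R u + b' *\<^sub>R v) v, u\<rangle>"
      using ab(5) ab'(5) unfolding add.assoc[of y] add.commute[of "s *\<^sub>R v"] by linarith
    then have "\<langle>hess (y + a *\<^sub>R v + b *\<^sub>R u) u, v\<rangle> = \<langle>hess (y + a' *\<^sub>R u + b' *\<^sub>R v) v, u\<rangle>" using that by simp
    moreover have "\<bar>\<langle>hess (y + a *\<^sub>R v + b *\<^sub>R u) u, v\<rangle> - \<langle>hess y u, v\<rangle>\<bar> \<le> s * K"
      using near[OF ab(1-4), of v u] by (simp add: K_def mult_ac)
    moreover have "\<bar>\<langle>hess (y + a' *\<^sub>R u + b' *\<^sub>R v) v, u\<rangle> - \<langle>hess y v, u\<rangle>\<bar> \<le> s * K"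
      using near[OF ab'(1-4), of u v] by (simp add: K_def mult_ac add.commute)
    ultimately show ?thesis by linarith
  qed
  let ?d = "\<bar>\<langle>hess y u, v\<rangle> - \<langle>hess y v, u\<rangle>\<bar>"
  have d: "0 < ?d" using neq by simp
  have "0 \<le> K" using L2_nonneg B by (simp add: K_def)
  \<comment> \<open>\<open>K\<close> may be zero, so \<open>M\<close> is the divisor instead; then
    \<open>2 * (s * K)\<close> is at most half of the supposed gap \<open>?d\<close>.\<close>
  define M where "M = K + 1"
  have "K \<le> M" "0 < M" using \<open>0 \<le> K\<close> by (simp_all add: M_def)
  define s where "s = ?d / 4 / M"
  have "0 < s" using d \<open>0 < M\<close> by (simp add: s_def)
  then have "s * K \<le> s * M" using \<open>K \<le> M\<close> by simp
  also have "\<dots> = ?d / 4" using \<open>0 < M\<close> by (simp add: s_def)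
  finally have "2 * (s * K) \<le> 2 * (?d / 4)" by (rule mult_left_mono) simp
  with K[OF \<open>0 < s\<close>] have "?d \<le> 2 * (?d / 4)" by (rule order.trans)
  then show False using neq by simp
qed

lemma spd_hess: "spd_op (hess y)"
  unfolding spd_op_def
proof (intro conjI allI impI linear_hess hess_sym)
  fix u :: 'a assume "u \<noteq> 0"
  then have "0 < \<mu> * \<langle>B u, u\<rangle>" using mu_pos spd_opD(3)[OF B] by simp
  then show "0 < \<langle>hess y u, u\<rangle>" using hess_ge[of u y] by linarith
qed

section \<open>Expansions of the function and convexity of its sublevel sets\<close>

lemma grad_xmin: "grad xmin = 0"
proof -
  have "blinfun_apply (grad xmin) = (\<lambda>v. 0)"
    using differential_zero_maxmin[of xmin UNIV f "blinfun_apply (grad xmin)"] gradient minimizer by auto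
  then show ?thesis by (intro blinfun_eqI) simp
qed

text \<open>The gradient is vector-valued, so the mean value theorem is applied to its value at a
  fixed \<open>v\<close>. The point \<tau> depends on \<open>v\<close>, and each use has to choose
  one test vector that serves the whole estimate.\<close>

lemma grad_mean_value:
  obtains \<tau> where "0 < \<tau>" "\<tau> < 1" "\<langle>grad (z + e) - grad z, v\<rangle> = \<langle>hess (z + \<tau> *\<^sub>R e) e, v\<rangle>"
proof -
  let ?\<phi> = "\<lambda>\<tau>. \<langle>grad (z + \<tau> *\<^sub>R e), v\<rangle>"
  have "\<exists>\<tau>>0. \<tau> < 1 \<and> ?\<phi> 1 - ?\<phi> 0 = (1 - 0) * \<langle>hess (z + \<tau> *\<^sub>R e) e, v\<rangle>"
    by (rule MVT2) (simp_all add: DERIV_grad_along)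
  then show thesis using that by (auto simp: blinfun.diff_left)
qed

lemma taylor:
  obtains \<tau> where "0 < \<tau>" "\<tau> < 1"
    "f (z + e) = f z + \<langle>grad z, e\<rangle> + \<langle>hess (z + \<tau> *\<^sub>R e) e, e\<rangle> / 2"
proof -
  define \<phi> where "\<phi> m \<tau> = (if m = (0::nat) then f (z + \<tau> *\<^sub>R e) else if m = 1 then \<langle>grad (z + \<tau> *\<^sub>R e), e\<rangle>
      else \<langle>hess (z + \<tau> *\<^sub>R e) e, e\<rangle>)" for m \<tau>
  have "DERIV (\<phi> m) \<tau> :> \<phi> (Suc m) \<tau>" if "m < 2" for m \<tau>
  proof (cases "m = 0")
    case True
    then show ?thesis using DERIV_along by (simp add: \<phi>_def[abs_def])
  next
    case False
    with that have "m = 1" by simp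
    then show ?thesis using DERIV_grad_along[of z e e \<tau>] by (simp add: \<phi>_def[abs_def])
  qed
  then have "\<exists>t::real. 0 < t \<and> t < 1 \<and>
      \<phi> 0 1 = (\<Sum>m<2. (\<phi> m 0 / fact m) * 1 ^ m) + (\<phi> 2 t / fact 2) * 1 ^ 2"
    by (intro Maclaurin) auto
  then obtain t where "0 < t" "t < 1" "\<phi> 0 1 = (\<Sum>m<2. \<phi> m 0 / fact m) + \<phi> 2 t / 2" by auto
  then show thesis using that[of t] by (simp add: \<phi>_def numeral_2_eq_2)
qed

lemma gradient_inequality: "f z + \<langle>grad z, e\<rangle> \<le> f (z + e)"
  by (rule taylor[of z e]) (use spd_opD(4)[OF spd_hess] in \<open>smt (verit) divide_nonneg_pos\<close>)

text \<open>The gradient inequality at the intermediate point is used towards the endpoint in whose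
  direction the slope is nonnegative. It keeps intermediate points of a segment in the sublevel set,
  where the Hessian is controlled.\<close>

lemma segment_le_max:
  assumes "0 \<le> \<tau>" "\<tau> \<le> 1" "f z \<le> F" "f (z + e) \<le> F"
  shows "f (z + \<tau> *\<^sub>R e) \<le> F"
proof (cases "0 \<le> \<langle>grad (z + \<tau> *\<^sub>R e), e\<rangle>")
  case True
  have "f (z + \<tau> *\<^sub>R e) + (1 - \<tau>) * \<langle>grad (z + \<tau> *\<^sub>R e), e\<rangle> \<le> f (z + e)"
    using gradient_inequality[of "z + \<tau> *\<^sub>R e" "(1 - \<tau>) *\<^sub>R e"]
    by (simp add: blinfun.scaleR_right blinfun.diff_right scaleR_diff_left algebra_simps)
  moreover have "0 \<le> (1 - \<tau>) * \<langle>grad (z + \<tau> *\<^sub>R e), e\<rangle>"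
    using True assms(2) by (intro mult_nonneg_nonneg) auto
  ultimately show ?thesis using assms by linarith
next
  case False
  have "f (z + \<tau> *\<^sub>R e) - \<tau> * \<langle>grad (z + \<tau> *\<^sub>R e), e\<rangle> \<le> f z"
    using gradient_inequality[of "z + \<tau> *\<^sub>R e" "- (\<tau> *\<^sub>R e)"]
    by (simp add: blinfun.scaleR_right blinfun.minus_right)
  moreover have "\<tau> * \<langle>grad (z + \<tau> *\<^sub>R e), e\<rangle> \<le> 0"
    using False assms(1) by (simp add: mult_nonneg_nonpos)
  ultimately show ?thesis using assms by linarith
qed

section \<open>Comparison of Hessians on sublevel sets\<close>

lemma quadratic_growth: "\<mu> * (primal_norm B (y - xmin))\<^sup>2 \<le> 2 * (f y - f xmin)"
proof -
  obtain \<tau> where "f (xmin + (y - xmin)) = f xmin + \<langle>grad xmin, y - xmin\<rangle>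
      + \<langle>hess (xmin + \<tau> *\<^sub>R (y - xmin)) (y - xmin), y - xmin\<rangle> / 2"
    by (rule taylor)
  then show ?thesis using hess_ge[of "y - xmin" "xmin + \<tau> *\<^sub>R (y - xmin)"] B by (simp add: grad_xmin)
qed

text \<open>The origin of the constant \<open>c\<close>: quadratic growth bounds the distance to
  \<open>xmin\<close> by \<open>sqrt (2 / \<mu>)\<close> times the root of the gap in value. The
  factor \<mu> is split off because strong convexity absorbs it when norms of \<open>B\<close>
  become local norms.\<close>

lemma near_sublevel:
  assumes "c = sqrt 2 * L\<^sub>2 / \<mu> powr (3 / 2)"
  shows "L\<^sub>2 * primal_norm B (y - xmin) \<le> \<mu> * (c * sqrt (f y - f xmin))"
proof -
  have "\<mu> powr (3 / 2) = \<mu> powr (1 + 1 / 2)" by simp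
  also have "\<dots> = \<mu> * sqrt \<mu>" unfolding powr_add using mu_pos by (simp add: powr_half_sqrt)
  finally have c: "\<mu> * c * sqrt \<mu> = sqrt 2 * L\<^sub>2" using mu_pos assms by simp
  have "sqrt \<mu> * primal_norm B (y - xmin) \<le> sqrt 2 * sqrt (f y - f xmin)"
    using real_sqrt_le_mono[OF quadratic_growth[of y]]
    unfolding real_sqrt_mult real_sqrt_abs abs_of_nonneg[OF primal_norm_nonneg[OF B]] .
  then have "L\<^sub>2 * (sqrt \<mu> * primal_norm B (y - xmin)) \<le> L\<^sub>2 * (sqrt 2 * sqrt (f y - f xmin))"
    using L2_nonneg by (rule mult_left_mono)
  also have "\<dots> = \<mu> * c * sqrt \<mu> * sqrt (f y - f xmin)" unfolding c by simp
  finally have "sqrt \<mu> * (L\<^sub>2 * primal_norm B (y - xmin)) \<le> sqrt \<mu> * (\<mu> * (c * sqrt (f y - f xmin)))"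
    by (simp add: mult_ac)
  then show ?thesis using mu_pos by simp
qed

lemma mu_norm_le:
  "\<mu> * (primal_norm B u * primal_norm B v) \<le> primal_norm (hess y) u * primal_norm (hess y) v"
proof -
  have *: "sqrt \<mu> * primal_norm B w \<le> primal_norm (hess y) w" for w
    using real_sqrt_le_mono[OF hess_ge[of w y]] by (simp add: primal_norm_def real_sqrt_mult)
  have "(sqrt \<mu> * primal_norm B u) * (sqrt \<mu> * primal_norm B v)
      \<le> primal_norm (hess y) u * primal_norm (hess y) v"
    by (intro mult_mono * primal_norm_nonneg spd_hess) (use B mu_pos in auto)
  moreover have "(sqrt \<mu> * primal_norm B u) * (sqrt \<mu> * primal_norm B v)
      = (sqrt \<mu> * sqrt \<mu>) * (primal_norm B u * primal_norm B v)" by (simp only: mult_ac)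
  ultimately show ?thesis using mu_pos by simp
qed

lemma near_nonneg:
  assumes "L\<^sub>2 * primal_norm B (y - xmin) \<le> \<mu> * s"
  shows "0 \<le> s"
proof -
  have "0 \<le> L\<^sub>2 * primal_norm B (y - xmin)" using L2_nonneg B by simp
  with assms have "0 \<le> \<mu> * s" by linarith
  then show ?thesis using mu_pos by (simp add: zero_le_mult_iff)
qed

text \<open>By \<open>mu_norm_le\<close> the factor \<mu> of the hypothesis turns the norms of
  \<open>B\<close> into those of any Hessian. The point \<open>z\<close> stays free:
  \<open>z = xmin\<close> and \<open>z = y\<close> give the upper and the lower comparison of
  \<open>hess y\<close> with \<open>A\<close>.\<close>

lemma hess_diff_le:
  assumes near: "L\<^sub>2 * primal_norm B (y - xmin) \<le> \<mu> * s"
  shows "\<bar>\<langle>hess y u - A u, v\<rangle>\<bar> \<le> s * (primal_norm (hess z) u * primal_norm (hess z) v)"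
proof -
  have "\<bar>\<langle>hess y u - A u, v\<rangle>\<bar> \<le> (L\<^sub>2 * primal_norm B (y - xmin)) * (primal_norm B u * primal_norm B v)"
    using hess_lipschitz[of y u xmin v] by (simp add: mult.assoc)
  also have "\<dots> \<le> (\<mu> * s) * (primal_norm B u * primal_norm B v)"
    by (intro mult_right_mono near) (use B in simp)
  also have "\<dots> = s * (\<mu> * (primal_norm B u * primal_norm B v))" by (simp only: mult_ac)
  also have "\<dots> \<le> s * (primal_norm (hess z) u * primal_norm (hess z) v)"
    by (intro mult_left_mono mu_norm_le near_nonneg[OF near])
  finally show ?thesis .
qed

lemma
  assumes near: "L\<^sub>2 * primal_norm B (y - xmin) \<le> \<mu> * s"
  shows hess_le_min: "\<langle>hess y u, u\<rangle> \<le> (1 + s) * \<langle>A u, u\<rangle>"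
    and hess_min_le: "\<langle>A u, u\<rangle> \<le> (1 + s) * \<langle>hess y u, u\<rangle>"
proof -
  have *: "primal_norm (hess z) u * primal_norm (hess z) u = \<langle>hess z u, u\<rangle>" for z
    using primal_norm_power2[OF spd_hess, of z u] by (simp add: power2_eq_square)
  show "\<langle>hess y u, u\<rangle> \<le> (1 + s) * \<langle>A u, u\<rangle>"
    using hess_diff_le[OF near, of u u xmin] unfolding * by (simp add: blinfun.diff_left distrib_right)
  show "\<langle>A u, u\<rangle> \<le> (1 + s) * \<langle>hess y u, u\<rangle>"
    using hess_diff_le[OF near, of u u y] unfolding * by (simp add: blinfun.diff_left distrib_right)
qed

text \<open>The second bound is what a Hessian average \<open>J\<close> with
  \<open>J \<delta> = \<gamma>\<close> and \<open>J \<le> (1 + s) A\<close> would give. The proof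
  avoids the average by expanding the nonnegative form of one intermediate Hessian at
  \<open>\<delta> - \<rho> v\<close>, where \<open>v = inv A \<gamma>\<close>.\<close>

lemma
  assumes near: "\<And>\<tau>. 0 \<le> \<tau> \<Longrightarrow> \<tau> \<le> 1 \<Longrightarrow> L\<^sub>2 * primal_norm B (z + \<tau> *\<^sub>R \<delta> - xmin) \<le> \<mu> * s"
  defines "\<gamma> \<equiv> grad (z + \<delta>) - grad z"
  shows curvature_lower: "\<langle>A \<delta>, \<delta>\<rangle> \<le> (1 + s) * \<langle>\<gamma>, \<delta>\<rangle>"
    and curvature_dual: "\<langle>\<gamma>, inv A \<gamma>\<rangle> \<le> (1 + s) * \<langle>\<gamma>, \<delta>\<rangle>"
proof -
  have s: "0 \<le> s" using near_nonneg[OF near[of 0]] by simp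
  obtain \<tau> where \<tau>: "0 < \<tau>" "\<tau> < 1" "\<langle>\<gamma>, \<delta>\<rangle> = \<langle>hess (z + \<tau> *\<^sub>R \<delta>) \<delta>, \<delta>\<rangle>"
    unfolding \<gamma>_def by (rule grad_mean_value)
  show "\<langle>A \<delta>, \<delta>\<rangle> \<le> (1 + s) * \<langle>\<gamma>, \<delta>\<rangle>"
    unfolding \<tau>(3) by (rule hess_min_le[OF near]) (use \<tau> in auto)
  define \<rho> where "\<rho> = 1 / (1 + s)"
  define v where "v = inv A \<gamma>"
  let ?N = "\<langle>\<gamma>, v\<rangle>"
  have Av: "A v = \<gamma>" by (simp add: v_def spd_hess)
  have \<rho>: "\<rho> * (1 + s) = 1" "0 < \<rho>" using s by (simp_all add: \<rho>_def)
  \<comment> \<open>This test vector gathers all terms of the expansion below that involve \<delta>,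
    so that one intermediate point serves them together.\<close>
  obtain \<tau>' where \<tau>': "0 < \<tau>'" "\<tau>' < 1"
    "\<langle>\<gamma>, (2 * \<rho>) *\<^sub>R v - \<delta>\<rangle> = \<langle>hess (z + \<tau>' *\<^sub>R \<delta>) \<delta>, (2 * \<rho>) *\<^sub>R v - \<delta>\<rangle>"
    unfolding \<gamma>_def by (rule grad_mean_value)
  let ?h = "hess (z + \<tau>' *\<^sub>R \<delta>)"
  interpret h: linear ?h by (rule linear_hess)
  have "0 \<le> \<langle>?h (\<delta> - \<rho> *\<^sub>R v), \<delta> - \<rho> *\<^sub>R v\<rangle>" by (rule spd_opD(4)[OF spd_hess])
  also have "\<dots> = \<rho>\<^sup>2 * \<langle>?h v, v\<rangle> - \<langle>?h \<delta>, (2 * \<rho>) *\<^sub>R v - \<delta>\<rangle>"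
    using hess_sym[of _ v \<delta>]
    by (simp add: h.diff h.scale blinfun.diff_left blinfun.diff_right blinfun.scaleR_left blinfun.scaleR_right
        power2_eq_square algebra_simps)
  also have "\<dots> = \<rho>\<^sup>2 * \<langle>?h v, v\<rangle> - (2 * \<rho> * ?N - \<langle>\<gamma>, \<delta>\<rangle>)"
    unfolding \<tau>'(3)[symmetric] by (simp add: blinfun.diff_right blinfun.scaleR_right)
  also have "\<rho>\<^sup>2 * \<langle>?h v, v\<rangle> \<le> \<rho>\<^sup>2 * ((1 + s) * ?N)"
    using hess_le_min[OF near[of \<tau>'], of v] \<tau>' by (intro mult_left_mono) (auto simp: Av)
  also have "\<rho>\<^sup>2 * ((1 + s) * ?N) = (\<rho> * (1 + s)) * (\<rho> * ?N)" by (simp only: power2_eq_square mult_ac)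
  also have "\<dots> = \<rho> * ?N" unfolding \<rho>(1) by simp
  finally have "\<rho> * ?N \<le> \<langle>\<gamma>, \<delta>\<rangle>" by simp
  then have "(1 + s) * (\<rho> * ?N) \<le> (1 + s) * \<langle>\<gamma>, \<delta>\<rangle>" using s by (intro mult_left_mono) auto
  moreover have "(1 + s) * (\<rho> * ?N) = ?N" using \<rho>(1) by (simp add: mult.assoc[symmetric] mult.commute)
  ultimately have "?N \<le> (1 + s) * \<langle>\<gamma>, \<delta>\<rangle>" by (simp only:)
  then show "\<langle>\<gamma>, inv A \<gamma>\<rangle> \<le> (1 + s) * \<langle>\<gamma>, \<delta>\<rangle>" by (simp only: v_def)
qed

section \<open>Local norm, value and gradient near the minimizer, and the unit step\<close>

lemma near_segment_min:
  assumes near: "L\<^sub>2 * primal_norm B (x - xmin) \<le> \<mu> * s" and "0 \<le> \<tau>" "\<tau> \<le> 1"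
  shows "L\<^sub>2 * primal_norm B (xmin + \<tau> *\<^sub>R (x - xmin) - xmin) \<le> \<mu> * s"
proof -
  have "\<tau> * primal_norm B (x - xmin) \<le> primal_norm B (x - xmin)"
    using assms(2,3) B by (intro mult_left_le_one_le) auto
  then have "L\<^sub>2 * (\<tau> * primal_norm B (x - xmin)) \<le> L\<^sub>2 * primal_norm B (x - xmin)"
    by (intro mult_left_mono L2_nonneg)
  with near show ?thesis using assms(2) B by (simp add: primal_norm_scaleR)
qed

text \<open>All three are read off along the segment from \<open>xmin\<close>, where the gradient
  vanishes; its points are no farther from \<open>xmin\<close> than \<open>x\<close>, so the bound
  at \<open>x\<close> covers them.\<close>

lemma
  assumes near: "L\<^sub>2 * primal_norm B (x - xmin) \<le> \<mu> * s"
  shows local_norm_le: "\<langle>A (x - xmin), x - xmin\<rangle> \<le> (1 + s) * (2 * (f x - f xmin))"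
    and value_gap_le: "2 * (f x - f xmin) \<le> (1 + s) * \<langle>A (x - xmin), x - xmin\<rangle>"
    and gradient_error: "dual_norm A (grad x - A (x - xmin)) \<le> s * primal_norm A (x - xmin)"
proof -
  let ?e = "x - xmin"
  obtain \<tau> where \<tau>: "0 < \<tau>" "\<tau> < 1"
    "f (xmin + ?e) = f xmin + \<langle>grad xmin, ?e\<rangle> + \<langle>hess (xmin + \<tau> *\<^sub>R ?e) ?e, ?e\<rangle> / 2"
    by (rule taylor)
  then have eq: "2 * (f x - f xmin) = \<langle>hess (xmin + \<tau> *\<^sub>R ?e) ?e, ?e\<rangle>" by (simp add: grad_xmin)
  have n: "L\<^sub>2 * primal_norm B (xmin + \<tau> *\<^sub>R ?e - xmin) \<le> \<mu> * s"
    using \<tau> by (intro near_segment_min near) auto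
  show "\<langle>A ?e, ?e\<rangle> \<le> (1 + s) * (2 * (f x - f xmin))" unfolding eq by (rule hess_min_le[OF n])
  show "2 * (f x - f xmin) \<le> (1 + s) * \<langle>A ?e, ?e\<rangle>" unfolding eq by (rule hess_le_min[OF n])
  show "dual_norm A (grad x - A ?e) \<le> s * primal_norm A ?e"
  proof (rule dual_norm_le[OF spd_hess])
    fix v
    obtain \<tau> where \<tau>: "0 < \<tau>" "\<tau> < 1"
      "\<langle>grad (xmin + ?e) - grad xmin, v\<rangle> = \<langle>hess (xmin + \<tau> *\<^sub>R ?e) ?e, v\<rangle>"
      by (rule grad_mean_value)
    have n: "L\<^sub>2 * primal_norm B (xmin + \<tau> *\<^sub>R ?e - xmin) \<le> \<mu> * s"
      using \<tau> by (intro near_segment_min near) auto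
    have "\<langle>grad x - A ?e, v\<rangle> = \<langle>hess (xmin + \<tau> *\<^sub>R ?e) ?e - A ?e, v\<rangle>"
      using \<tau>(3) by (simp add: grad_xmin blinfun.diff_left)
    then show "\<langle>grad x - A ?e, v\<rangle> \<le> s * primal_norm A ?e * primal_norm A v"
      using hess_diff_le[OF n, of ?e v xmin] by (simp add: mult.assoc)
  next
    show "0 \<le> s * primal_norm A ?e" using near_nonneg[OF near] spd_hess by simp
  qed
qed

text \<open>
  The Lipschitz bound is only available on the sublevel set, so it is first excluded that the unit
  step leaves it: otherwise some shorter step would return exactly to the level of \<open>x\<close>, contrary to
  the second order expansion there.
\<close>

lemma unit_step_decrease:
  assumes near: "\<And>y. f y \<le> f x \<Longrightarrow> L\<^sub>2 * primal_norm B (y - xmin) \<le> \<mu> * s"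
    and q: "0 < \<langle>grad x, d\<rangle>"
    and D: "(1 + s) * \<langle>A d, d\<rangle> \<le> 2 * (1 - \<eta>) * \<langle>grad x, d\<rangle>" and \<eta>: "0 < \<eta>" "\<eta> < 1"
  shows "f (x - d) \<le> f x - \<eta> * \<langle>grad x, d\<rangle>"
proof -
  let ?q = "\<langle>grad x, d\<rangle>"
  \<comment> \<open>The condition \<open>le\<close> keeps the segment up to \<tau> in the sublevel
    set; there the Hessian bound and \<open>D\<close> control the quadratic term.\<close>
  have expand: "f (x - \<tau> *\<^sub>R d) \<le> f x - \<tau> * ?q + \<tau>\<^sup>2 * ((1 - \<eta>) * ?q)"
    if \<tau>: "0 < \<tau>" "\<tau> \<le> 1" and le: "f (x - \<tau> *\<^sub>R d) \<le> f x" for \<tau>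
  proof -
    obtain a where a: "0 < a" "a < 1"
      "f (x + - (\<tau> *\<^sub>R d)) = f x + \<langle>grad x, - (\<tau> *\<^sub>R d)\<rangle>
        + \<langle>hess (x + a *\<^sub>R (- (\<tau> *\<^sub>R d))) (- (\<tau> *\<^sub>R d)), - (\<tau> *\<^sub>R d)\<rangle> / 2"
      by (rule taylor)
    let ?y = "x + a *\<^sub>R (- (\<tau> *\<^sub>R d))"
    interpret h: linear "hess ?y" by (rule linear_hess)
    have "f ?y \<le> f x" using a le by (intro segment_le_max) auto
    from hess_le_min[OF near[OF this], of d] D
    have "\<langle>hess ?y d, d\<rangle> \<le> 2 * ((1 - \<eta>) * ?q)" by linarith
    then have "\<tau>\<^sup>2 * \<langle>hess ?y d, d\<rangle> \<le> \<tau>\<^sup>2 * (2 * ((1 - \<eta>) * ?q))" by (intro mult_left_mono) auto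
    moreover have "f (x - \<tau> *\<^sub>R d) = f x - \<tau> * ?q + \<tau>\<^sup>2 * \<langle>hess ?y d, d\<rangle> / 2"
      using a(3) by (simp only: h.neg h.scale blinfun.minus_left blinfun.minus_right blinfun.scaleR_left
          blinfun.scaleR_right power2_eq_square) simp
    ultimately show ?thesis by linarith
  qed
  have "f (x - d) \<le> f x"
  proof (rule ccontr)
    assume gt: "\<not> f (x - d) \<le> f x"
    let ?\<phi> = "\<lambda>\<tau>. f (x + \<tau> *\<^sub>R (- d))"
    have der: "DERIV ?\<phi> \<tau> :> \<langle>grad (x + \<tau> *\<^sub>R (- d)), - d\<rangle>" for \<tau> by (rule DERIV_along)
    have "\<exists>\<epsilon>>0. \<forall>h>0. h < \<epsilon> \<longrightarrow> ?\<phi> (0 + h) < ?\<phi> 0"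
      using DERIV_neg_dec_right[OF der[of 0]] q by (simp add: blinfun.minus_right)
    then obtain \<epsilon> where \<epsilon>: "0 < \<epsilon>" "\<And>h. 0 < h \<Longrightarrow> h < \<epsilon> \<Longrightarrow> ?\<phi> h < f x" by auto
    \<comment> \<open>Starting the intermediate value argument at \<open>a > 0\<close>, where
      \<open>f\<close> is already below its value at \<open>x\<close>, excludes the trivial solution
      \<open>\<tau> = 0\<close>.\<close>
    define a where "a = min \<epsilon> 1 / 2"
    have a: "0 < a" "a < \<epsilon>" "a \<le> 1" using \<epsilon>(1) by (auto simp: a_def min_def)
    have "continuous_on {a..1} ?\<phi>"
      by (intro continuous_at_imp_continuous_on ballI DERIV_isCont[OF der])
    then obtain \<tau> where \<tau>: "a \<le> \<tau>" "\<tau> \<le> 1" "?\<phi> \<tau> = f x"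
      using IVT'[of ?\<phi> a "f x" 1] \<epsilon>(2)[OF a(1,2)] a(3) gt by auto
    have "f x \<le> f x - \<tau> * ?q + \<tau>\<^sup>2 * ((1 - \<eta>) * ?q)" using expand[of \<tau>] \<tau> a by simp
    then have "0 \<le> (\<tau> * ?q) * (\<tau> * (1 - \<eta>) - 1)" by (simp add: power2_eq_square algebra_simps)
    moreover have "0 < \<tau> * ?q" using \<tau> a q by simp
    moreover have "\<tau> * (1 - \<eta>) \<le> 1 * (1 - \<eta>)" using \<tau> \<eta> by (intro mult_right_mono) auto
    ultimately show False using \<eta> by (smt (verit) mult_pos_neg)
  qed
  then show ?thesis using expand[of 1] by (simp add: algebra_simps)
qed

text \<open>The step is compared with the exact one for \<open>A\<close>, which is
  \<open>inv A (grad x)\<close>. The latter misses \<open>xmin\<close> by the gradient error, at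
  most \<open>s\<close> times the local norm; the hypothesis on \<theta> says that \<open>d\<close>
  differs from it by at most the fraction \<theta>, and its length is at most \<open>1 + s\<close>
  times the local norm.\<close>

lemma unit_step_contraction:
  assumes near: "L\<^sub>2 * primal_norm B (x - xmin) \<le> \<mu> * s"
    and \<theta>: "0 \<le> \<theta>"
      "\<langle>A d, d\<rangle> - 2 * \<langle>grad x, d\<rangle> + \<langle>grad x, inv A (grad x)\<rangle> \<le> \<theta>\<^sup>2 * \<langle>grad x, inv A (grad x)\<rangle>"
  shows "primal_norm A (x - d - xmin) \<le> (\<theta> * (1 + s) + s) * primal_norm A (x - xmin)"
proof -
  note sA = spd_hess[of xmin]
  interpret a: linear A by (rule linear_hess)
  interpret i: linear "inv A" by (rule spd_op_linear_inv[OF sA])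
  let ?e = "x - xmin" and ?g = "grad x"
  let ?u = "inv A (?g - A ?e)"
  let ?v = "inv A ?g - d"
  have u: "primal_norm A ?u \<le> s * primal_norm A ?e"
    using gradient_error[OF near] sA by (simp add: dual_norm_eq)
  have split: "inv A ?g = ?u + ?e" by (simp add: i.diff sA)
  have g: "primal_norm A (inv A ?g) \<le> (1 + s) * primal_norm A ?e"
    using primal_norm_triangle[OF sA, of ?u ?e] u unfolding split[symmetric] distrib_right by linarith
  have "(primal_norm A ?v)\<^sup>2 = \<langle>A d, d\<rangle> - 2 * \<langle>?g, d\<rangle> + \<langle>?g, inv A ?g\<rangle>"
    using spd_opD(2)[OF sA, of d "inv A ?g"]
    by (simp add: primal_norm_power2[OF sA] a.diff sA blinfun.diff_left blinfun.diff_right)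
  also have "\<dots> \<le> \<theta>\<^sup>2 * \<langle>?g, inv A ?g\<rangle>" by (rule \<theta>)
  also have "\<dots> = (\<theta> * primal_norm A (inv A ?g))\<^sup>2"
    unfolding power_mult_distrib primal_norm_power2[OF sA] by (simp add: sA)
  finally have "primal_norm A ?v \<le> \<theta> * primal_norm A (inv A ?g)"
    by (rule power2_le_imp_le) (simp add: \<theta> sA)
  also have "\<dots> \<le> \<theta> * ((1 + s) * primal_norm A ?e)" by (intro mult_left_mono g \<theta>)
  finally have v: "primal_norm A ?v \<le> \<theta> * ((1 + s) * primal_norm A ?e)" .
  have split': "x - d - xmin = - ?u + ?v" by (simp add: i.diff sA)
  have "primal_norm A (x - d - xmin) \<le> primal_norm A ?u + primal_norm A ?v"
    using primal_norm_triangle[OF sA, of "- ?u" ?v] unfolding split' primal_norm_minus[OF sA] .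
  then show ?thesis using u v by (simp add: distrib_right mult.assoc)
qed

end

section \<open>Scalar inequalities\<close>

lemma omega_strict_mono:
  assumes "0 \<le> s" "s < t"
  shows "omega s < omega t"
proof (rule DERIV_pos_imp_increasing_open[OF assms(2)])
  show "\<exists>y. DERIV omega x :> y \<and> 0 < y" if "s < x" "x < t" for x
    using that assms unfolding omega_def[abs_def]
    by (intro exI[of _ "1 - 1 / (1 + x)"] conjI) (auto intro!: derivative_eq_intros)
  show "continuous_on {s..t} omega"
    using assms unfolding omega_def[abs_def] by (intro continuous_intros) auto
qed

lemma omega_le_square:
  assumes "0 \<le> s"
  shows "omega s \<le> s\<^sup>2 / 2"
proof -
  have "0\<^sup>2 / 2 - omega 0 \<le> s\<^sup>2 / 2 - omega s"
  proof (rule DERIV_nonneg_imp_nondecreasing[OF assms])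
    fix x :: real assume x: "0 \<le> x" "x \<le> s"
    have "((\<lambda>x. x\<^sup>2 / 2 - omega x) has_real_derivative x - (1 - 1 / (1 + x))) (at x)"
      using x unfolding omega_def by (auto intro!: derivative_eq_intros)
    moreover have "0 \<le> x - (1 - 1 / (1 + x))" using x by (simp add: field_simps)
    ultimately show "\<exists>y. DERIV (\<lambda>x. x\<^sup>2 / 2 - omega x) x :> y \<and> 0 \<le> y" by blast
  qed
  then show ?thesis by (simp add: omega_def)
qed

text \<open>With \<open>s = sqrt (2 * y)\<close> the Taylor bound
  \<open>1 + s + s\<^sup>2 / 2 \<le> exp s\<close> reads \<open>1 + s + y \<le> exp s\<close>; take
  logarithms.\<close>

lemma le_omega_sqrt_plus:
  assumes "0 \<le> y"
  shows "y \<le> omega (sqrt (2 * y) + y)"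
proof -
  let ?s = "sqrt (2 * y)"
  have "1 + ?s + ?s\<^sup>2 / 2 \<le> exp ?s" using assms by (intro exp_lower_Taylor_quadratic) simp
  then have "1 + (?s + y) \<le> exp ?s" using assms by simp
  then have "ln (1 + (?s + y)) \<le> ln (exp ?s)"
    using assms by (subst ln_le_cancel_iff) (auto intro: add_pos_nonneg)
  then show ?thesis by (simp add: omega_def)
qed

lemma
  assumes "0 \<le> y"
  shows omega_inv_nonneg: "0 \<le> omega_inv y"
    and omega_omega_inv: "omega (omega_inv y) = y"
    and omega_inv_le_sqrt: "omega_inv y \<le> sqrt (2 * y) + y"
proof -
  have inj: "inj_on omega {0..}"
    by (intro linorder_inj_onI) (use omega_strict_mono in force)+
  have "\<exists>x\<ge>0. x \<le> sqrt (2 * y) + y \<and> omega x = y"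
    using assms le_omega_sqrt_plus[OF assms]
    by (intro IVT') (auto simp: omega_def[abs_def] intro!: continuous_intros)
  then obtain x where x: "0 \<le> x" "x \<le> sqrt (2 * y) + y" "omega x = y" by blast
  then have "omega_inv y = x" unfolding omega_inv_def using inj by (intro the_inv_into_f_eq) auto
  then show "0 \<le> omega_inv y" "omega (omega_inv y) = y" "omega_inv y \<le> sqrt (2 * y) + y"
    using x by auto
qed

lemma omega_tangent:
  assumes "0 \<le> m" "0 \<le> z"
  shows "omega m + (1 - 1 / (1 + m)) * (z - m) \<le> omega z"
proof -
  have "ln ((1 + z) / (1 + m)) \<le> (1 + z) / (1 + m) - 1" using assms by (intro ln_le_minus_one) simp
  also have "\<dots> = (z - m) / (1 + m)" using assms by (simp add: field_simps)
  finally have "ln (1 + z) - ln (1 + m) \<le> (z - m) / (1 + m)" using assms by (simp add: ln_divide_pos)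
  then show ?thesis by (simp add: omega_def algebra_simps)
qed

text \<open>Jensen's inequality: in the sum of the tangent bounds at the mean \<open>m\<close> the
  linear parts cancel, which leaves \<open>omega m \<le> W / real k\<close>.\<close>

lemma mean_le_omega_inv:
  assumes k: "0 < k" and z: "\<And>i. i < k \<Longrightarrow> 0 \<le> z i" and le: "(\<Sum>i<k. omega (z i)) \<le> W"
  shows "(\<Sum>i<k. z i) \<le> real k * omega_inv (W / real k)"
proof -
  define m where "m = (\<Sum>i<k. z i) / real k"
  have km: "real k * m = (\<Sum>i<k. z i)" using k by (simp add: m_def)
  have m: "0 \<le> m" unfolding m_def using z by (intro divide_nonneg_nonneg sum_nonneg) auto
  have "(\<Sum>i<k. omega m + (1 - 1 / (1 + m)) * (z i - m)) \<le> (\<Sum>i<k. omega (z i))"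
    by (intro sum_mono omega_tangent m z) simp
  also have "(\<Sum>i<k. omega m + (1 - 1 / (1 + m)) * (z i - m)) = real k * omega m"
    by (simp add: sum.distrib sum_subtractf km flip: sum_distrib_left)
  finally have "real k * omega m \<le> W" using le by linarith
  then have le': "omega m \<le> W / real k" using k by (simp add: field_simps)
  have "0 \<le> omega m" using omega_strict_mono[of 0 m] m by (cases "m = 0") (auto simp: omega_def)
  then have W: "0 \<le> W / real k" using le' by linarith
  have "m \<le> omega_inv (W / real k)"
  proof (rule ccontr)
    assume "\<not> m \<le> omega_inv (W / real k)"
    then have "omega (omega_inv (W / real k)) < omega m"
      using omega_inv_nonneg[OF W] by (intro omega_strict_mono) auto
    then show False using omega_omega_inv[OF W] le' by simp
  qed
  then show ?thesis unfolding km[symmetric] by (intro mult_left_mono) auto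
qed

lemma omega_star_mono:
  assumes "0 \<le> s" "s \<le> t" "t < 1"
  shows "omega_star s \<le> omega_star t"
proof (rule DERIV_nonneg_imp_nondecreasing[OF assms(2)])
  fix x assume "s \<le> x" "x \<le> t"
  then have x: "0 \<le> x" "x < 1" using assms by auto
  have "(omega_star has_real_derivative - 1 + 1 / (1 - x)) (at x)"
    unfolding omega_star_def[abs_def] using x by (auto intro!: derivative_eq_intros)
  moreover have "0 \<le> - 1 + 1 / (1 - x)" using x by (simp add: field_simps)
  ultimately show "\<exists>y. DERIV omega_star x :> y \<and> 0 \<le> y" by blast
qed

lemma omega_star_pos:
  assumes "0 < t" "t < 1"
  shows "0 < omega_star t"
  using ln_less_self[of "1 - t"] assms ln_eq_minus_one[of "1 - t"] ln_le_minus_one[of "1 - t"]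
  by (auto simp: omega_star_def less_le)

text \<open>For the two quotients \<open>a\<close>, \<open>b\<close> of \<open>discrepancy\<close>
  the right side is the discrepancy and the bracket the squared relative error of the step. At
  \<open>a = b\<close> the claim is \<open>0 \<le> F b\<close>: the derivative of \<open>F\<close>
  has the sign of \<open>x - 1\<close> while \<open>x\<^sup>2\<close> exceeds \<open>7 / 25\<close>,
  which is below \<open>(11 / 20)\<^sup>2\<close>. Raising \<open>a\<close> above \<open>b\<close>
  adds \<open>a - b\<close> to the right side and no more than that to the left.\<close>

lemma log_gap_ge:
  assumes b: "11 / 20 \<le> b" and ab: "b \<le> a"
  shows "7 / 50 * (1 - 2 / a + 1 / (a * b)) \<le> a - 1 - ln (b::real)"
proof -
  define F where "F x = x - 1 - ln x - 7 / 50 * (1 - 1 / x)\<^sup>2" for x :: real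
  have der: "(F has_real_derivative (1 - 1 / x) * (1 - 7 / 25 / x\<^sup>2)) (at x)" if "0 < x" for x
    unfolding F_def[abs_def] using that
    by (auto intro!: derivative_eq_intros simp: field_simps power2_eq_square)
  have pos: "0 \<le> 1 - 7 / 25 / x\<^sup>2" if "11 / 20 \<le> x" for x :: real
  proof -
    have "(11 / 20)\<^sup>2 \<le> x\<^sup>2" using that by (intro power_mono) auto
    then have "7 / 25 \<le> x\<^sup>2" by (simp add: power2_eq_square)
    then show ?thesis using that by simp
  qed
  have "0 \<le> F b"
  proof (cases "1 \<le> b")
    case True
    have "F 1 \<le> F b"
    proof (rule DERIV_nonneg_imp_nondecreasing[OF True])
      show "\<exists>y. DERIV F x :> y \<and> 0 \<le> y" if "1 \<le> x" "x \<le> b" for x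
        by (intro exI[of _ "(1 - 1 / x) * (1 - 7 / 25 / x\<^sup>2)"] conjI der mult_nonneg_nonneg pos) (use that in simp_all)
    qed
    then show ?thesis by (simp add: F_def)
  next
    case False
    have "F 1 \<le> F b"
    proof (rule DERIV_nonpos_imp_nonincreasing[of b 1 F])
      show "b \<le> 1" using False by simp
      show "\<exists>y. DERIV F x :> y \<and> y \<le> 0" if "b \<le> x" "x \<le> 1" for x
        by (intro exI[of _ "(1 - 1 / x) * (1 - 7 / 25 / x\<^sup>2)"] conjI der mult_nonpos_nonneg pos) (use that b in simp_all)
    qed
    then show ?thesis by (simp add: F_def)
  qed
  moreover have "7 / 50 * (1 - 2 / a + 1 / (a * b)) - 7 / 50 * (1 - 1 / b)\<^sup>2 \<le> a - b"
  proof -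
    have a: "0 < a" "0 < b" using b ab by auto
    have "7 / 50 * (1 - 2 / a + 1 / (a * b)) - 7 / 50 * (1 - 1 / b)\<^sup>2
        = (a - b) * (7 / 50 * (2 * b - 1)) / (a * b * b)"
      using a by (simp add: field_simps power2_eq_square)
    also have "\<dots> \<le> (a - b) * 1"
    proof -
      have "7 / 50 * (2 * b - 1) \<le> b * b * b"
      proof -
        \<comment> \<open>The tangent of the cube at \<open>1 / 2\<close>: it gives
          \<open>3 / 4 * b - 1 / 4\<close> as a lower bound for the cube of
          \<open>b\<close>.\<close>
        have "0 \<le> (b - 1 / 2)\<^sup>2 * (b + 1)" using a by simp
        then have "0 \<le> b * b * b - 3 / 4 * b + 1 / 4"
          by (simp add: power2_eq_square field_simps)
        moreover define e where "e = b * b * b"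
        ultimately have "7 / 50 * (2 * b - 1) \<le> e" using b by simp
        then show ?thesis by (simp only: e_def)
      qed
      also have "\<dots> \<le> a * b * b" using a ab by (intro mult_right_mono) auto
      finally have "7 / 50 * (2 * b - 1) / (a * b * b) \<le> 1" using a by simp
      then have "(a - b) * (7 / 50 * (2 * b - 1) / (a * b * b)) \<le> (a - b) * 1"
        using ab by (intro mult_left_mono) auto
      then show ?thesis by simp
    qed
    finally show ?thesis by simp
  qed
  ultimately show ?thesis unfolding F_def by linarith
qed

lemma prod_le_mean_power:
  fixes \<rho> :: "nat \<Rightarrow> real"
  assumes k: "0 < k" and nonneg: "\<And>i. i < k \<Longrightarrow> 0 \<le> \<rho> i" and le: "(\<Sum>i<k. \<rho> i) \<le> real k * M"
  shows "(\<Prod>i<k. \<rho> i) \<le> M ^ k"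
proof -
  define P where "P = (\<Prod>i<k. \<rho> i)"
  have P: "0 \<le> P" unfolding P_def using nonneg by (intro prod_nonneg) auto
  have "P powr (1 / real k) \<le> (\<Sum>i<k. \<rho> i / real k)"
    using arith_geom_mean[of "{..<k}" \<rho>] k nonneg by (auto simp: P_def)
  also have "\<dots> = (\<Sum>i<k. \<rho> i) / real k" by (simp add: sum_divide_distrib)
  also have "\<dots> \<le> M" using le k by (simp add: field_simps)
  finally have "(P powr (1 / real k)) ^ k \<le> M ^ k" by (intro power_mono) auto
  moreover have "(P powr (1 / real k)) ^ k = P"
  proof (cases "P = 0")
    case False
    then have "(P powr (1 / real k)) ^ k = (P powr (1 / real k)) powr real k"
      by (intro powr_realpow[symmetric]) simp
    also have "\<dots> = P" using k P by (simp add: powr_powr)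
    finally show ?thesis .
  qed (use k in simp)
  ultimately show ?thesis by (simp add: P_def)
qed

section \<open>Superlinear convergence\<close>

text \<open>\<open>B\<close> serves as a linear isomorphism onto the dual:
  \<open>H \<circ> B\<close> is an endomorphism, so its injectivity makes \<open>H\<close>
  surjective.\<close>

lemma spd_dual_op_inverse:
  fixes H :: "('a::euclidean_space \<Rightarrow>\<^sub>L real) \<Rightarrow> 'a"
  assumes H: "spd_dual_op H" and B: "spd_op (B :: 'a \<Rightarrow> ('a \<Rightarrow>\<^sub>L real))"
  shows "spd_op (inv H)" and "bij H"
proof -
  have lin: "linear H" and sym: "\<And>s t. \<langle>s, H t\<rangle> = \<langle>t, H s\<rangle>"
    and pos: "\<And>s. s \<noteq> 0 \<Longrightarrow> 0 < \<langle>s, H s\<rangle>"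
    using H unfolding spd_dual_op_def by auto
  have inj: "inj H"
  proof -
    have "s = 0" if "H s = 0" for s using pos[of s] that by (cases "s = 0") auto
    then show ?thesis using lin linear_injective_0 by blast
  qed
  have "linear (H \<circ> B)" using spd_opD(1)[OF B] lin by (rule linear_compose)
  moreover have "inj (H \<circ> B)" using inj bij_is_inj[OF spd_op_bij[OF B]] by (rule inj_compose)
  ultimately have "surj (H \<circ> B)" by (rule linear_inj_imp_surj)
  then have surj: "surj H" unfolding surj_def o_def by blast
  show "bij H" using inj surj by (rule bijI)
  have HG: "H (inv H u) = u" for u using surj by (rule surj_f_inv_f)
  show "spd_op (inv H)"
    unfolding spd_op_def
  proof (intro conjI allI impI)
    show "linear (inv H)"
    proof (rule linearI)
      show "inv H (u + v) = inv H u + inv H v" for u v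
        by (rule injD[OF inj]) (simp add: linear_add[OF lin] HG)
      show "inv H (a *\<^sub>R u) = a *\<^sub>R inv H u" for a u
        by (rule injD[OF inj]) (simp add: linear_scale[OF lin] HG)
    qed
    show "\<langle>inv H u, v\<rangle> = \<langle>inv H v, u\<rangle>" for u v
      using sym[of "inv H u" "inv H v"] by (simp add: HG)
    fix u :: 'a assume "u \<noteq> 0"
    then have "inv H u \<noteq> 0" using HG[of u] linear_0[OF lin] by metis
    then show "0 < \<langle>inv H u, u\<rangle>" using pos[of "inv H u"] by (simp add: HG)
  qed
qed

context strongly_convex_objective
begin

text \<open>The deviation of \<gamma> from \<open>A \<delta>\<close> enters twice, through the trace
  quotient, at most \<open>1 + s\<close>, and through a logarithm, at most
  \<open>ln (1 + s) \<le> s\<close>. Descent keeps the segment between the iterates in the sublevel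
  set, where both bounds hold.\<close>

lemma psi_bfgs_step:
  assumes near: "\<And>y. f y \<le> f x \<Longrightarrow> L\<^sub>2 * primal_norm B (y - xmin) \<le> \<mu> * s"
    and G: "spd_op G" and h: "0 < h" and x': "x' = x - h *\<^sub>R d" and dec: "f x' \<le> f x"
    and p: "0 < \<langle>grad x' - grad x, x' - x\<rangle>"
  shows "psi A (bfgs_direct G (x' - x) (grad x' - grad x)) \<le> psi A G - discrepancy A G d + 2 * s"
proof -
  define \<delta> where "\<delta> = x' - x"
  define \<gamma> where "\<gamma> = grad x' - grad x"
  have s: "0 \<le> s" using near_nonneg[OF near[of x]] by simp
  have p: "0 < \<langle>\<gamma>, \<delta>\<rangle>" using p by (simp add: \<delta>_def \<gamma>_def)
  then have "\<delta> \<noteq> 0" by auto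
  then have D: "0 < \<langle>A \<delta>, \<delta>\<rangle>" by (rule spd_opD(3)[OF spd_hess])
  have seg: "L\<^sub>2 * primal_norm B (x + \<tau> *\<^sub>R \<delta> - xmin) \<le> \<mu> * s" if "0 \<le> \<tau>" "\<tau> \<le> 1" for \<tau>
    by (intro near segment_le_max that) (simp_all add: \<delta>_def dec)
  have \<gamma>: "grad (x + \<delta>) - grad x = \<gamma>" by (simp add: \<delta>_def \<gamma>_def)
  have N: "\<langle>\<gamma>, inv A \<gamma>\<rangle> / \<langle>\<gamma>, \<delta>\<rangle> \<le> 1 + s"
    using curvature_dual[OF seg] p unfolding \<gamma> by (simp add: field_simps)
  have "\<langle>A \<delta>, \<delta>\<rangle> / \<langle>\<gamma>, \<delta>\<rangle> \<le> 1 + s"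
    using curvature_lower[OF seg] p unfolding \<gamma> by (simp add: field_simps)
  then have "ln (\<langle>A \<delta>, \<delta>\<rangle> / \<langle>\<gamma>, \<delta>\<rangle>) \<le> ln (1 + s)" using p D s by (subst ln_le_cancel_iff) auto
  also have "\<dots> \<le> s" by (rule ln_add_one_self_le_self[OF s])
  finally have "- ln (\<langle>\<gamma>, \<delta>\<rangle> / \<langle>A \<delta>, \<delta>\<rangle>) \<le> s" using p D by (simp add: ln_divide_pos)
  moreover have "\<delta> = (- h) *\<^sub>R d" by (simp add: \<delta>_def x')
  then have "discrepancy A G \<delta> = discrepancy A G d"
    using h discrepancy_scaleR[OF spd_hess G, of "- h"] by simp
  ultimately show ?thesis
    using psi_bfgs_direct[OF spd_hess[of xmin] G p conjunct1[OF spd_det_pos_psi_nonneg[OF spd_hess G]]] N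
    unfolding \<delta>_def[symmetric] \<gamma>_def[symmetric] by linarith
qed

text \<open>A detour through function values: squared local norm and twice the gap in value agree up
  to the factor \<open>1 + s\<close>, used once at each point, and descent links the two
  gaps.\<close>

lemma local_norm_sublevel:
  assumes near: "\<And>y. f y \<le> f x \<Longrightarrow> L\<^sub>2 * primal_norm B (y - xmin) \<le> \<mu> * s"
    and dec: "f x' \<le> f x"
  shows "primal_norm A (x' - xmin) \<le> (1 + s) * primal_norm A (x - xmin)"
proof (rule power2_le_imp_le)
  have s: "0 \<le> s" using near_nonneg[OF near[of x]] by simp
  have "(primal_norm A (x' - xmin))\<^sup>2 \<le> (1 + s) * (2 * (f x' - f xmin))"
    using local_norm_le[OF near[OF dec]] by (simp add: spd_hess)
  also have "\<dots> \<le> (1 + s) * (2 * (f x - f xmin))" using dec s by (intro mult_left_mono) auto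
  also have "\<dots> \<le> (1 + s) * ((1 + s) * \<langle>A (x - xmin), x - xmin\<rangle>)"
    using value_gap_le[OF near[of x]] s by (intro mult_left_mono) auto
  also have "\<dots> = ((1 + s) * primal_norm A (x - xmin))\<^sup>2"
    unfolding power_mult_distrib primal_norm_power2[OF spd_hess] by (simp add: power2_eq_square)
  finally show "(primal_norm A (x' - xmin))\<^sup>2 \<le> ((1 + s) * primal_norm A (x - xmin))\<^sup>2" .
  show "0 \<le> (1 + s) * primal_norm A (x - xmin)" using s spd_hess by simp
qed

text \<open>
  An iteration with \<open>\<langle>G d, d\<rangle> / \<langle>A d, d\<rangle> \<le> 1 - t\<close> costs at least \<open>\<omega>\<^sub>*(t)\<close> of the potential and hardly
  increases the local norm (\<open>\<beta> = 1\<close>, \<open>z = 0\<close>); otherwise the unit step is accepted and the contraction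
  factor is controlled by the potential (\<open>\<beta> = 0\<close>). The constant \<open>53/101\<close> is \<open>1.06/2.02\<close>.
\<close>

lemma bfgs_step_contraction:
  assumes near: "\<And>y. f y \<le> f x \<Longrightarrow> L\<^sub>2 * primal_norm B (y - xmin) \<le> \<mu> * s"
    and G: "spd_op G" and Gd: "G d = grad x" and d: "d \<noteq> 0"
    and step: "backtracking_step f grad \<eta> x d h" and x': "x' = x - h *\<^sub>R d" and dec: "f x' \<le> f x"
    and \<eta>: "0 < \<eta>" "\<eta> < 1 / 2" and s: "s \<le> 0.06 * (1 - 2 * \<eta>)"
    and t: "t = 0.9 * ((1 - 2 * \<eta>) / (2 * (1 - \<eta>)))"
  obtains z \<beta> where "0 \<le> z" "0 \<le> \<beta>" "omega z \<le> discrepancy A G d" "\<beta> * omega_star t \<le> discrepancy A G d"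
    "primal_norm A (x' - xmin) \<le> (2.02 * z + \<beta> + s) * primal_norm A (x - xmin)"
proof -
  note sA = spd_hess[of xmin]
  let ?g = "grad x"
  define q where "q = \<langle>?g, d\<rangle>"
  define D where "D = \<langle>A d, d\<rangle>"
  define W where "W = \<langle>?g, inv A ?g\<rangle>"
  have q: "0 < q" using spd_opD(3)[OF G d] by (simp add: q_def Gd)
  have D: "0 < D" using spd_opD(3)[OF sA d] by (simp add: D_def)
  have "?g \<noteq> 0" using q by (auto simp: q_def)
  then have W: "0 < W" unfolding W_def by (rule dual_pairing_pos[OF sA])
  have \<Delta>: "discrepancy A G d = W / q - 1 - ln (q / D)"
    by (simp add: discrepancy_def Gd W_def q_def D_def)
  have s0: "0 \<le> s" using near_nonneg[OF near[of x]] by simp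
  have t0: "0 \<le> t" using \<eta> by (simp add: t)
  have t1: "2 * (1 - \<eta>) * t = 0.9 * (1 - 2 * \<eta>)"
  proof -
    define e where "e = 2 * (1 - \<eta>)"
    have "e \<noteq> 0" using \<eta> by (simp add: e_def)
    then show ?thesis unfolding t e_def[symmetric] by simp
  qed
  have t2: "t \<le> 0.45" using \<eta> by (simp add: t field_simps)
  have rn: "0 \<le> primal_norm A (x - xmin)" using sA by simp
  show thesis
  proof (cases "q / D \<le> 1 - t")
    case True
    have b: "0 < q / D" using q D by simp
    \<comment> \<open>For \<open>b = q / D\<close> the value \<open>omega_star (1 - b)\<close> is
      \<open>b - 1 - ln b\<close>.\<close>
    have "omega_star t \<le> omega_star (1 - q / D)" using t0 True b by (intro omega_star_mono) auto
    also have "\<dots> \<le> discrepancy A G d"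
      using discrepancy_ge[OF sA G d] by (simp add: omega_star_def Gd q_def D_def)
    finally have os: "omega_star t \<le> discrepancy A G d" .
    show thesis
      by (rule that[of 0 1])
        (use local_norm_sublevel[OF near dec] discrepancy_nonneg[OF sA G d] os in \<open>simp_all add: omega_def\<close>)
  next
    case False
    then have good: "(1 - t) * D \<le> q" using D by (simp add: field_simps)
    \<comment> \<open>The right factor equals \<open>1 + 0.1 * (1 - 2 * \<eta>)\<close>. Without the
      \<open>0.9\<close> in \<open>t\<close> it would be \<open>1\<close> and leave no room for a
      positive \<open>s\<close>.\<close>
    have "(1 + s) * D \<le> (2 * (1 - \<eta>) * (1 - t)) * D"
    proof (rule mult_right_mono)
      have "2 * (1 - \<eta>) * (1 - t) = 2 * (1 - \<eta>) - 0.9 * (1 - 2 * \<eta>)"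
        using t1 by (simp add: right_diff_distrib)
      then show "1 + s \<le> 2 * (1 - \<eta>) * (1 - t)" using s \<eta> by (simp add: field_simps)
    qed (use D in simp)
    also have "\<dots> \<le> 2 * (1 - \<eta>) * q" using good \<eta> by (simp add: mult.assoc)
    finally have "(1 + s) * D \<le> 2 * (1 - \<eta>) * q" .
    then have "f (x - d) \<le> f x - \<eta> * q"
      using \<eta> q unfolding q_def D_def by (intro unit_step_decrease[OF near]) auto
    then have "armijo f grad \<eta> x d 0" by (simp add: armijo_def q_def)
    then have "h = 1" using step unfolding backtracking_step_def by (metis div_by_1 gr0I power_0)
    \<comment> \<open>The distance of \<open>d\<close> from \<open>inv A ?g\<close> relative to the
      length of the latter, in the norm of \<open>A\<close>. For \<open>a = W / q\<close> and
      \<open>b = q / D\<close> its square is \<open>1 - 2 / a + 1 / (a * b)\<close>.\<close>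
    define \<theta> where "\<theta> = sqrt ((D - 2 * q + W) / W)"
    have nn: "0 \<le> D - 2 * q + W"
    proof -
      interpret a: linear A by (rule linear_hess)
      have "0 \<le> \<langle>A (inv A ?g - d), inv A ?g - d\<rangle>" by (rule spd_opD(4)[OF sA])
      then show ?thesis using spd_opD(2)[OF sA, of d "inv A ?g"]
        by (simp add: a.diff sA blinfun.diff_left blinfun.diff_right q_def D_def W_def)
    qed
    have \<theta>: "0 \<le> \<theta>" "\<theta>\<^sup>2 = (D - 2 * q + W) / W" using nn W by (simp_all add: \<theta>_def)
    have "11 / 20 \<le> 1 - t" using t2 by simp
    also have "\<dots> \<le> q / D" using False by simp
    finally have "11 / 20 \<le> q / D" .
    moreover have "q / D \<le> W / q" using ratio_cauchy[OF sA, of ?g d] q by (simp add: q_def D_def W_def)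
    ultimately have "7 / 50 * (1 - 2 / (W / q) + 1 / ((W / q) * (q / D))) \<le> discrepancy A G d"
      unfolding \<Delta> by (rule log_gap_ge)
    also have "1 - 2 / (W / q) + 1 / ((W / q) * (q / D)) = \<theta>\<^sup>2"
      unfolding \<theta>(2) using W q D by (simp add: field_simps)
    finally have \<Delta>\<theta>: "7 / 50 * \<theta>\<^sup>2 \<le> discrepancy A G d" .
    \<comment> \<open>The number \<open>(53 / 101)\<^sup>2 / 2\<close> is about
      \<open>0.1377\<close>, just below \<open>7 / 50\<close>.\<close>
    have "omega (53 / 101 * \<theta>) \<le> (53 / 101 * \<theta>)\<^sup>2 / 2" using \<theta>(1) by (intro omega_le_square) simp
    also have "\<dots> \<le> 7 / 50 * \<theta>\<^sup>2" by (simp add: power_mult_distrib power_divide)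
    finally have z: "omega (53 / 101 * \<theta>) \<le> discrepancy A G d" using \<Delta>\<theta> by linarith
    have "primal_norm A (x' - xmin) \<le> (\<theta> * (1 + s) + s) * primal_norm A (x - xmin)"
      unfolding x' \<open>h = 1\<close> scaleR_one
    proof (rule unit_step_contraction[OF near \<theta>(1)])
      show "\<langle>A d, d\<rangle> - 2 * \<langle>?g, d\<rangle> + \<langle>?g, inv A ?g\<rangle> \<le> \<theta>\<^sup>2 * \<langle>?g, inv A ?g\<rangle>"
        using \<theta>(2) W by (simp add: q_def D_def W_def)
    qed simp
    also have "\<dots> \<le> (2.02 * (53 / 101 * \<theta>) + 0 + s) * primal_norm A (x - xmin)"
    proof (rule mult_right_mono[OF _ rn])
      have "\<theta> * (1 + s) \<le> \<theta> * 1.06" using s \<eta> \<theta>(1) by (intro mult_left_mono) auto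
      then show "\<theta> * (1 + s) + s \<le> 2.02 * (53 / 101 * \<theta>) + 0 + s" by simp
    qed
    finally show thesis
      using \<theta>(1) z discrepancy_nonneg[OF sA G d] by (intro that[of "53 / 101 * \<theta>" 0]) auto
  qed
qed

end

theorem theorem5p14:
  fixes B :: "'a::euclidean_space \<Rightarrow> ('a \<Rightarrow>\<^sub>L real)"
    and f :: "'a \<Rightarrow> real"
    and grad :: "'a \<Rightarrow> ('a \<Rightarrow>\<^sub>L real)"
    and hess :: "'a \<Rightarrow> 'a \<Rightarrow> ('a \<Rightarrow>\<^sub>L real)"
    and \<mu> L L\<^sub>2 c \<eta>\<^sub>1 S \<Omega> t \<Upsilon> :: real
    and xmin :: 'a
    and x :: "nat \<Rightarrow> 'a"
    and H :: "nat \<Rightarrow> ('a \<Rightarrow>\<^sub>L real) \<Rightarrow> 'a"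
    and h \<sigma> r :: "nat \<Rightarrow> real"
    and K\<^sub>0 :: nat
  assumes B: "spd_op B"
    and pos: "0 < \<mu>" "0 < L" "0 \<le> L\<^sub>2"
    and gradient: "\<And>y. (f has_derivative blinfun_apply (grad y)) (at y)"
    and hessian: "\<And>y. (grad has_derivative hess y) (at y)"
    and strongly_convex:
      "\<And>y z. \<langle>grad y - grad z, y - z\<rangle> \<ge> \<mu> * (primal_norm B (y - z))\<^sup>2"
    and lipschitz_gradient:
      "\<And>y z. dual_norm B (grad y - grad z) \<le> L * primal_norm B (y - z)"
    and lipschitz_hessian:
      "\<And>y z. op_norm B (\<lambda>u. hess y u - hess z u) \<le> L\<^sub>2 * primal_norm B (y - z)"
    and minimizer: "\<And>y. f xmin \<le> f y"
    and c: "c = sqrt 2 * L\<^sub>2 / \<mu> powr (3 / 2)"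
    and \<eta>\<^sub>1: "0 < \<eta>\<^sub>1" "\<eta>\<^sub>1 < 1 / 2"
    and bfgs: "bfgs_method grad x H h"
    and line_search: "\<And>k. backtracking_step f grad \<eta>\<^sub>1 (x k) (H k (grad (x k))) (h k)"
    and \<sigma>: "\<And>k. \<sigma> k = sqrt (f (x k) - f xmin)"
    and r: "\<And>k. r k = sqrt \<langle>hess xmin (x k - xmin), x k - xmin\<rangle>"
    and S: "\<And>k. k \<ge> 1 \<Longrightarrow> c * (\<Sum>i<k. \<sigma> i) \<le> S"
    and \<Omega>: "\<Omega> = psi (hess xmin) (inv (H 0)) + 2 * S"
    and K\<^sub>0: "c * \<sigma> K\<^sub>0 \<le> 0.06 * (1 - 2 * \<eta>\<^sub>1)"
    and t: "t = 0.9 * ((1 - 2 * \<eta>\<^sub>1) / (2 * (1 - \<eta>\<^sub>1)))"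
    and \<Upsilon>: "\<Upsilon> = inverse (omega_star t)"
  shows "\<forall>k\<ge>1.
      r (K\<^sub>0 + k) \<le> (2.02 * omega_inv (\<Omega> / real k) + (1 / real k) * (\<Upsilon> * \<Omega> + S)) ^ k * r K\<^sub>0 \<and>
      (2.02 * omega_inv (\<Omega> / real k) + (1 / real k) * (\<Upsilon> * \<Omega> + S)) ^ k * r K\<^sub>0
        \<le> (2.02 * sqrt (2 * \<Omega> / real k) + (1 / real k) * ((\<Upsilon> + 2.02) * \<Omega> + S)) ^ k * r K\<^sub>0"
proof -
  interpret strongly_convex_objective B f grad hess \<mu> L\<^sub>2 xmin
    by unfold_locales (fact B pos gradient hessian strongly_convex lipschitz_hessian minimizer)+
  note sA = spd_hess[of xmin]
  have H0: "spd_dual_op (H 0)"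
    and h: "\<And>k. 0 < h k"
    and x: "\<And>k. x (Suc k) = x k - h k *\<^sub>R H k (grad (x k))"
    and H: "\<And>k. H (Suc k) = bfgs_update (H k) (x (Suc k) - x k) (grad (x (Suc k)) - grad (x k))"
    and p: "\<And>k. 0 < \<langle>grad (x (Suc k)) - grad (x k), x (Suc k) - x k\<rangle>"
    using bfgs unfolding bfgs_method_def by blast+
  define G where "G k = inv (H k)" for k
  define d where "d k = H k (grad (x k))" for k
  define s where "s k = c * \<sigma> k" for k
  define \<Delta> where "\<Delta> k = discrepancy A (G k) (d k)" for k

  \<comment> \<open>Both parts are carried together: \<open>G k\<close> is defined as an inverse,
    and inverting it back to \<open>H k\<close> needs bijectivity.\<close>
  have GH: "spd_op (G k) \<and> H k = inv (G k)" for k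
  proof (induction k)
    case 0
    then show ?case using spd_dual_op_inverse[OF H0 B] by (simp add: G_def inv_inv_eq)
  next
    case (Suc k)
    have "H (Suc k) = inv (bfgs_direct (G k) (x (Suc k) - x k) (grad (x (Suc k)) - grad (x k)))"
      unfolding H using Suc bfgs_update_inverse[OF _ p] by simp
    moreover have "spd_op (bfgs_direct (G k) (x (Suc k) - x k) (grad (x (Suc k)) - grad (x k)))"
      using Suc spd_bfgs_direct[OF _ p] by simp
    ultimately show ?case by (simp add: G_def inv_inv_eq spd_op_bij)
  qed
  have G: "spd_op (G k)" for k using GH by simp
  have G_Suc: "G (Suc k) = bfgs_direct (G k) (x (Suc k) - x k) (grad (x (Suc k)) - grad (x k))" for k
    unfolding G_def[of "Suc k"] H
    using GH[of k] bfgs_update_inverse[OF G p] spd_bfgs_direct[OF G p]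
    by (simp add: inv_inv_eq spd_op_bij)
  have Gd: "G k (d k) = grad (x k)" for k
    using GH[of k] spd_op_inv(1)[OF G] by (simp add: d_def)
  have x': "x (Suc k) = x k - h k *\<^sub>R d k" for k by (simp add: x d_def)
  have d: "d k \<noteq> 0" for k using p[of k] by (auto simp: x')

  have dec: "f (x (Suc k)) \<le> f (x k)" for k
  proof -
    obtain i where i: "h k = 1 / 2 ^ i" "armijo f grad \<eta>\<^sub>1 (x k) (d k) i"
      using line_search[of k] unfolding backtracking_step_def d_def by auto
    have "0 \<le> \<langle>grad (x k), d k\<rangle>" using spd_opD(4)[OF G, of k "d k"] by (simp add: Gd)
    then have "0 \<le> \<eta>\<^sub>1 * h k * \<langle>grad (x k), d k\<rangle>" using \<eta>\<^sub>1 h[of k] by simp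
    then show ?thesis using i unfolding armijo_def x' by simp
  qed
  have c0: "0 \<le> c" using pos by (simp add: c)
  have s0: "0 \<le> s k" for k using c0 minimizer by (simp add: s_def \<sigma>)
  have s_le: "s (K\<^sub>0 + k) \<le> 0.06 * (1 - 2 * \<eta>\<^sub>1)" for k
  proof (induction k)
    case (Suc k)
    have "s (Suc (K\<^sub>0 + k)) \<le> s (K\<^sub>0 + k)"
      unfolding s_def \<sigma> using dec c0 by (intro mult_left_mono) auto
    with Suc show ?case by simp
  qed (use K\<^sub>0 in \<open>simp add: s_def\<close>)
  have near: "L\<^sub>2 * primal_norm B (y - xmin) \<le> \<mu> * s k" if "f y \<le> f (x k)" for y k
  proof -
    have "\<mu> * (c * sqrt (f y - f xmin)) \<le> \<mu> * (c * \<sigma> k)"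
      unfolding \<sigma> using that c0 mu_pos by (intro mult_left_mono) auto
    then show ?thesis using near_sublevel[OF c, of y] by (simp add: s_def)
  qed

  have \<Delta>0: "0 \<le> \<Delta> k" for k unfolding \<Delta>_def by (rule discrepancy_nonneg[OF sA G d])
  have potential: "psi A (G n) + (\<Sum>i<n. \<Delta> i) \<le> psi A (G 0) + 2 * (\<Sum>i<n. s i)" for n
  proof (induction n)
    case (Suc n)
    have "psi A (G (Suc n)) \<le> psi A (G n) - \<Delta> n + 2 * s n"
      unfolding G_Suc \<Delta>_def by (rule psi_bfgs_step[OF near G h x' dec p])
    with Suc show ?case by simp
  qed simp
  have split: "(\<Sum>i<K\<^sub>0 + k. u i) = (\<Sum>i<K\<^sub>0. u i) + (\<Sum>i<k. u (K\<^sub>0 + i))" for u :: "nat \<Rightarrow> real" and k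
    by (induction k) simp_all
  \<comment> \<open>The potential has to be summed from index \<open>0\<close>, since \<Omega>
    refers to \<open>H 0\<close>; the nonnegative terms before \<open>K\<^sub>0\<close> are then
    dropped.\<close>
  have S_bound: "(\<Sum>i<k. s (K\<^sub>0 + i)) \<le> S" and \<Delta>_bound: "(\<Sum>i<k. \<Delta> (K\<^sub>0 + i)) \<le> \<Omega>" if "1 \<le> k" for k
  proof -
    have S': "(\<Sum>i<K\<^sub>0 + k. s i) \<le> S"
      using S[of "K\<^sub>0 + k"] that by (simp add: s_def sum_distrib_left)
    moreover have "0 \<le> (\<Sum>i<K\<^sub>0. s i)" "0 \<le> (\<Sum>i<K\<^sub>0. \<Delta> i)"
      using s0 \<Delta>0 by (simp_all add: sum_nonneg)
    ultimately show "(\<Sum>i<k. s (K\<^sub>0 + i)) \<le> S" using split[of s k] by linarith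
    have "0 \<le> psi A (G (K\<^sub>0 + k))" using spd_det_pos_psi_nonneg[OF sA G] by blast
    then show "(\<Sum>i<k. \<Delta> (K\<^sub>0 + i)) \<le> \<Omega>"
      using potential[of "K\<^sub>0 + k"] S' split[of \<Delta> k] \<open>0 \<le> (\<Sum>i<K\<^sub>0. \<Delta> i)\<close>
      by (simp add: \<Omega> G_def)
  qed

  have r_eq: "r k = primal_norm A (x k - xmin)" for k by (simp add: r primal_norm_def)
  have r0: "0 \<le> r k" for k by (simp add: r_eq sA)
  \<comment> \<open>As a real weight, \<beta> turns the number of bad iterations into a sum that the
    potential bounds term by term.\<close>
  have "\<exists>z \<beta>. 0 \<le> z \<and> 0 \<le> \<beta> \<and> omega z \<le> \<Delta> (K\<^sub>0 + i) \<and> \<beta> * omega_star t \<le> \<Delta> (K\<^sub>0 + i)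
      \<and> r (Suc (K\<^sub>0 + i)) \<le> (2.02 * z + \<beta> + s (K\<^sub>0 + i)) * r (K\<^sub>0 + i)" for i
    unfolding \<Delta>_def r_eq
    by (rule bfgs_step_contraction[OF near G Gd d line_search[folded d_def] x' dec \<eta>\<^sub>1 s_le t]) blast+
  then obtain z \<beta> where z: "\<And>i. 0 \<le> z i" "\<And>i. omega (z i) \<le> \<Delta> (K\<^sub>0 + i)"
    and \<beta>: "\<And>i. 0 \<le> \<beta> i" "\<And>i. \<beta> i * omega_star t \<le> \<Delta> (K\<^sub>0 + i)"
    and contraction: "\<And>i. r (Suc (K\<^sub>0 + i)) \<le> (2.02 * z i + \<beta> i + s (K\<^sub>0 + i)) * r (K\<^sub>0 + i)"
    by metis
  define \<rho> where "\<rho> i = 2.02 * z i + \<beta> i + s (K\<^sub>0 + i)" for i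
  have \<rho>0: "0 \<le> \<rho> i" for i using z(1) \<beta>(1) s0 by (simp add: \<rho>_def)
  have r_prod: "r (K\<^sub>0 + k) \<le> (\<Prod>i<k. \<rho> i) * r K\<^sub>0" for k
  proof (induction k)
    case (Suc k)
    have "r (K\<^sub>0 + Suc k) \<le> \<rho> k * r (K\<^sub>0 + k)" using contraction[of k] by (simp add: \<rho>_def)
    also have "\<dots> \<le> \<rho> k * ((\<Prod>i<k. \<rho> i) * r K\<^sub>0)" by (intro mult_left_mono Suc \<rho>0)
    finally show ?case by (simp add: mult_ac)
  qed simp
  have t01: "0 < t" "t < 1" using \<eta>\<^sub>1 by (simp_all add: t field_simps)
  have \<Upsilon>0: "0 < omega_star t" using t01 by (rule omega_star_pos)

  show ?thesis
  proof (intro allI impI)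
    fix k :: nat assume k: "1 \<le> k"
    let ?M = "2.02 * omega_inv (\<Omega> / real k) + (1 / real k) * (\<Upsilon> * \<Omega> + S)"
    let ?N = "2.02 * sqrt (2 * \<Omega> / real k) + (1 / real k) * ((\<Upsilon> + 2.02) * \<Omega> + S)"
    have \<Omega>0: "0 \<le> \<Omega>" using \<Delta>_bound[OF k] sum_nonneg[of "{..<k}" "\<lambda>i. \<Delta> (K\<^sub>0 + i)"] \<Delta>0 by fastforce
    have S0: "0 \<le> S" using S_bound[OF k] sum_nonneg[of "{..<k}" "\<lambda>i. s (K\<^sub>0 + i)"] s0 by fastforce
    have \<Omega>k: "0 \<le> \<Omega> / real k" using \<Omega>0 by simp
    have "(\<Sum>i<k. omega (z i)) \<le> \<Omega>"
      using sum_mono[of "{..<k}" "\<lambda>i. omega (z i)" "\<lambda>i. \<Delta> (K\<^sub>0 + i)"] z(2) \<Delta>_bound[OF k] by fastforce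
    then have zs: "(\<Sum>i<k. z i) \<le> real k * omega_inv (\<Omega> / real k)"
      using k z(1) by (intro mean_le_omega_inv) auto
    have "(\<Sum>i<k. \<beta> i) * omega_star t \<le> \<Omega>"
      using sum_mono[of "{..<k}" "\<lambda>i. \<beta> i * omega_star t" "\<lambda>i. \<Delta> (K\<^sub>0 + i)"] \<beta>(2) \<Delta>_bound[OF k]
      unfolding sum_distrib_right by fastforce
    then have \<beta>s: "(\<Sum>i<k. \<beta> i) \<le> \<Upsilon> * \<Omega>" using \<Upsilon>0 by (simp add: \<Upsilon> field_simps)
    have "(\<Sum>i<k. \<rho> i) = 2.02 * (\<Sum>i<k. z i) + (\<Sum>i<k. \<beta> i) + (\<Sum>i<k. s (K\<^sub>0 + i))"
      by (simp add: \<rho>_def sum.distrib sum_distrib_left)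
    also have "\<dots> \<le> 2.02 * (real k * omega_inv (\<Omega> / real k)) + \<Upsilon> * \<Omega> + S"
      by (intro add_mono mult_left_mono zs \<beta>s S_bound[OF k]) simp
    also have "\<dots> = real k * ?M" using k by (simp add: field_simps)
    finally have "(\<Prod>i<k. \<rho> i) \<le> ?M ^ k" using k \<rho>0 by (intro prod_le_mean_power) auto
    then have "r (K\<^sub>0 + k) \<le> ?M ^ k * r K\<^sub>0"
      using r_prod[of k] mult_right_mono[OF _ r0] order.trans by blast
    moreover have "?M ^ k * r K\<^sub>0 \<le> ?N ^ k * r K\<^sub>0"
    proof (intro mult_right_mono power_mono r0)
      show "0 \<le> ?M" using omega_inv_nonneg[OF \<Omega>k] \<Upsilon>0 \<Omega>0 S0 by (simp add: \<Upsilon>)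
      \<comment> \<open>The surplus \<open>\<Omega> / real k\<close> over the square root, times
        \<open>2.02\<close>, is the origin of the \<open>2.02\<close> next to \<Upsilon>.\<close>
      have "omega_inv (\<Omega> / real k) \<le> sqrt (2 * \<Omega> / real k) + \<Omega> / real k"
        using omega_inv_le_sqrt[OF \<Omega>k] by simp
      then have "?M \<le> 2.02 * (sqrt (2 * \<Omega> / real k) + \<Omega> / real k) + (1 / real k) * (\<Upsilon> * \<Omega> + S)"
        by simp
      also have "\<dots> = ?N" by (simp add: algebra_simps add_divide_distrib)
      finally show "?M \<le> ?N" .
    qed
    ultimately show "r (K\<^sub>0 + k) \<le> ?M ^ k * r K\<^sub>0 \<and> ?M ^ k * r K\<^sub>0 \<le> ?N ^ k * r K\<^sub>0" ..
  qed
qed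

end
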